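(* Let $G^+$ be a Garside monoid of spherical type with Garside element $\Delta$, and let $\alpha,\beta$ be the exponential growth rates of $|\mathrm{PSeq}_k|$ and $|G^+_{(k)}|$. For each $k$ let $\nu_k$ be the uniform probability measure on $G^+_{(k)}$, and let $\mu_{\mathcal A}$ be the uniform probability measure on the set $\mathcal A$ of atoms of $G^+$. Let $\Gamma\setminus\{1_\Gamma\}$ be the directed graph with vertex set $\mathcal D^{\circ}$ and an edge from $s_2$ to $s_1$ if and only if $\partial s_2\wedge s_1=\mathbf 1$. If $\Gamma\setminus\{1_\Gamma\}$ is strongly connected and $\alpha=\beta$ holds, then the expected value of the penetration distance with respect to $\nu_k\times\mu_{\mathcal A}$ satisfies $$\lim_{k\to\infty}\mathbf{E}_{\nu_k\times\mu_{\mathcal A}}[\mathrm{pd}]=\infty.$$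
   Context: Garside monoids. In a cancellative monoid $M$ with unit $\mathbf 1$ write $x\preccurlyeq y$ if $xc=y$ for some $c\in M$, and $x\succcurlyeq y$ if $x=cy$ for some $c\in M$. An element $s$ is an atom if $s=ab$ implies $a=\mathbf 1$ or $b=\mathbf 1$ (atoms are understood to be $\ne\mathbf 1$); $\mathcal A$ is the set of atoms. $M$ is a Garside monoid of spherical type if it is a lattice with respect to both $\preccurlyeq$ and $\succcurlyeq$, has no strict infinite descending chains for either order, and there is $\Delta\in M$ (a Garside element, fixed) such that $\mathcal D=\{s: s\preccurlyeq\Delta\}=\{s:\Delta\succcurlyeq s\}$ is finite and generates $M$. Elements of $\mathcal D$ are the simple elements; $\mathcal D^{\circ}=\mathcal D\setminus\{\mathbf 1,\Delta\}$ is the set of proper simple elements. $x\wedge y$ denotes the gcd with respect to $\preccurlyeq$. For $s\in\mathcal D$, $\partial s\in\mathcal D$ is the unique element with $s\,\partial s=\Delta$. $M$ embeds in its group of fractions. Normal form. Every $x\in M$ can be written uniquely as $x=x_1\cdots x_m$ with $x_i\in\mathcal D\setminus\{\mathbf 1\}$ and $\partial x_i\wedge x_{i+1}=\mathbf 1$ for $1\le i<m$ (left normal form). It has the form $\Delta^{r}y_1\cdots y_l$ with $y_i\in\mathcal D^{\circ}$; put $\inf(x)=r$, $\mathrm{cl}(x)=l$. Set $G^+_{(k)}=\{x\in G^+:\mathrm{cl}(x)=k,\ \inf(x)=0\}$. Penetration distance. For $x,y\in G^+$, $$\mathrm{pd}(x,y)=\mathrm{cl}(x)-\max\{i\in\{0,\dots,\mathrm{cl}(x)\}: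 x\Delta^{-\inf(x)}\wedge\Delta^i=xy\Delta^{-\inf(xy)}\wedge\Delta^i\}.$$ Penetration sequences. A word $(s_k,m_k)\cdots(s_2,m_2)(s_1,m_1)$ over $\mathcal D^{\circ}\times\mathcal D^{\circ}$ is a penetration sequence of length $k$ if $m_1\preccurlyeq\partial s_1$ and, for all $1\le i<k$: $s_im_i\ne\Delta$, $\partial s_{i+1}\wedge s_i=\mathbf 1$, and $m_{i+1}=\partial s_{i+1}\wedge s_im_i$. $\mathrm{PSeq}_k$ is the set of penetration sequences of length $k$. Growth rates. $\alpha=\lim_{k\to\infty}|\mathrm{PSeq}_k|^{1/k}$ and $\beta=\lim_{k\to\infty}|G^+_{(k)}|^{1/k}$ (these limits exist). The graph $\Gamma\setminus\{1_\Gamma\}$ is the finite automaton accepting the normal forms of elements of $\bigcup_kG^+_{(k)}$ with its initial state $1_\Gamma$ removed. The measure $\nu_k$ is considered for those $k$ for which $G^+_{(k)}\neq\emptyset$. *)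

theory Defs
  imports "HOL-Probability.Probability" "Graph_Theory.Digraph_Component"
begin

section \<open>Garside monoids of spherical type\<close>

definition left_dvd :: "'a::monoid_mult \<Rightarrow> 'a \<Rightarrow> bool"  (infix \<open>\<preceq>\<close> 50)
  where "x \<preceq> y \<longleftrightarrow> (\<exists>c. x * c = y)"

text \<open>The order is oriented so that \<open>x \<succeq> y\<close> means that \<open>y\<close> is a right divisor of \<open>x\<close>.\<close>

definition right_mult :: "'a::monoid_mult \<Rightarrow> 'a \<Rightarrow> bool"  (infix \<open>\<succeq>\<close> 50)
  where "x \<succeq> y \<longleftrightarrow> (\<exists>c. x = c * y)"

definition monoid_atoms :: "'a::monoid_mult set"
  where "monoid_atoms = {s. s \<noteq> 1 \<and> (\<forall>a b. s = a * b \<longrightarrow> a = 1 \<or> b = 1)}"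

definition simples :: "'a::monoid_mult \<Rightarrow> 'a set"
  where "simples \<Delta> = {s. s \<preceq> \<Delta>}"

definition proper_simples :: "'a::monoid_mult \<Rightarrow> 'a set"
  where "proper_simples \<Delta> = simples \<Delta> - {1, \<Delta>}"

text \<open>
  The monoid is the whole type; \<open>\<Delta>\<close> is the fixed Garside element.
  In particular the two divisibility relations are antisymmetric, as part of being lattice orders.
\<close>

locale garside_monoid =
  fixes \<Delta> :: "'a::monoid_mult"
  assumes left_cancel: "\<And>a b c :: 'a. a * b = a * c \<Longrightarrow> b = c"
    and right_cancel: "\<And>a b c :: 'a. b * a = c * a \<Longrightarrow> b = c"
    and left_lattice: "\<exists>meet join :: 'a \<Rightarrow> 'a \<Rightarrow> 'a.
          class.lattice meet (\<lambda>x y. x \<preceq> y) (\<lambda>x y. x \<preceq> y \<and> x \<noteq> y) join"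
    and right_lattice: "\<exists>meet join :: 'a \<Rightarrow> 'a \<Rightarrow> 'a.
          class.lattice meet (\<lambda>x y. y \<succeq> x) (\<lambda>x y. y \<succeq> x \<and> x \<noteq> y) join"
    and left_no_chain: "\<nexists>f :: nat \<Rightarrow> 'a. \<forall>i. f (Suc i) \<preceq> f i \<and> f (Suc i) \<noteq> f i"
    and right_no_chain: "\<nexists>f :: nat \<Rightarrow> 'a. \<forall>i. f i \<succeq> f (Suc i) \<and> f (Suc i) \<noteq> f i"
    and left_right_simples: "{s. s \<preceq> \<Delta>} = {s. \<Delta> \<succeq> s}"
    and finite_simples: "finite (simples \<Delta>)"
    and simples_generate: "\<And>x :: 'a. \<exists>xs. set xs \<subseteq> simples \<Delta> \<and> prod_list xs = x"

definition left_gcd :: "'a::monoid_mult \<Rightarrow> 'a \<Rightarrow> 'a"  (infixl \<open>\<^bold>\<and>\<close> 65)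
  where "x \<^bold>\<and> y = (THE d. d \<preceq> x \<and> d \<preceq> y \<and> (\<forall>e. e \<preceq> x \<and> e \<preceq> y \<longrightarrow> e \<preceq> d))"

definition compl :: "'a::monoid_mult \<Rightarrow> 'a \<Rightarrow> 'a"
  where "compl \<Delta> s = (THE t. s * t = \<Delta>)"


section \<open>Normal form and penetration distance\<close>

definition is_left_normal_form :: "'a::monoid_mult \<Rightarrow> 'a \<Rightarrow> 'a list \<Rightarrow> bool"
  where "is_left_normal_form \<Delta> x xs \<longleftrightarrow>
    prod_list xs = x \<and> set xs \<subseteq> simples \<Delta> - {1} \<and>
    (\<forall>i. Suc i < length xs \<longrightarrow> compl \<Delta> (xs ! i) \<^bold>\<and> xs ! Suc i = 1)"

definition normal_form :: "'a::monoid_mult \<Rightarrow> 'a \<Rightarrow> 'a list"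
  where "normal_form \<Delta> x = (THE xs. is_left_normal_form \<Delta> x xs)"

definition infimum :: "'a::monoid_mult \<Rightarrow> 'a \<Rightarrow> nat"
  where "infimum \<Delta> x =
    (THE r. \<exists>ys. set ys \<subseteq> proper_simples \<Delta> \<and> normal_form \<Delta> x = replicate r \<Delta> @ ys)"

definition canonical_length :: "'a::monoid_mult \<Rightarrow> 'a \<Rightarrow> nat"
  where "canonical_length \<Delta> x =
    (THE l. \<exists>r ys. set ys \<subseteq> proper_simples \<Delta> \<and> normal_form \<Delta> x = replicate r \<Delta> @ ys \<and> length ys = l)"

definition layer :: "'a::monoid_mult \<Rightarrow> nat \<Rightarrow> 'a set"
  where "layer \<Delta> k = {x. canonical_length \<Delta> x = k \<and> infimum \<Delta> x = 0}"

text \<open>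
  The element \<open>x \<Delta>\<^sup>-\<^sup>r\<close> of the group of fractions, where \<open>r\<close> is the infimum of \<open>x\<close>. It lies in the
  monoid because \<open>\<Delta>\<close> is quasi-central, so it is the unique monoid element \<open>z\<close> with \<open>z \<Delta>\<^sup>r = x\<close>.
\<close>

definition strip_infimum :: "'a::monoid_mult \<Rightarrow> 'a \<Rightarrow> 'a"
  where "strip_infimum \<Delta> x = (THE z. z * \<Delta> ^ infimum \<Delta> x = x)"

definition pd :: "'a::monoid_mult \<Rightarrow> 'a \<Rightarrow> 'a \<Rightarrow> nat"
  where "pd \<Delta> x y = canonical_length \<Delta> x -
    Max {i \<in> {0..canonical_length \<Delta> x}.
           strip_infimum \<Delta> x \<^bold>\<and> \<Delta> ^ i = strip_infimum \<Delta> (x * y) \<^bold>\<and> \<Delta> ^ i}"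


section \<open>Penetration sequences and growth rates\<close>

text \<open>
  The word \<open>(s\<^sub>k, m\<^sub>k) \<dots> (s\<^sub>1, m\<^sub>1)\<close> is indexed from right to left, so the letter
  with index \<open>i\<close> is at list position \<open>k - i\<close>.
\<close>

definition penetration_seqs :: "'a::monoid_mult \<Rightarrow> nat \<Rightarrow> ('a \<times> 'a) list set"
  where "penetration_seqs \<Delta> k =
    {w. length w = k \<and> set w \<subseteq> proper_simples \<Delta> \<times> proper_simples \<Delta> \<and>
        (let s = (\<lambda>i. fst (w ! (k - i))); m = (\<lambda>i. snd (w ! (k - i))) in
          (1 \<le> k \<longrightarrow> m 1 \<preceq> compl \<Delta> (s 1)) \<and>
          (\<forall>i. 1 \<le> i \<and> i < k \<longrightarrow>
             s i * m i \<noteq> \<Delta> \<and>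
             compl \<Delta> (s (i + 1)) \<^bold>\<and> s i = 1 \<and>
             m (i + 1) = compl \<Delta> (s (i + 1)) \<^bold>\<and> (s i * m i)))}"

definition growth_rate :: "(nat \<Rightarrow> 'b set) \<Rightarrow> real"
  where "growth_rate A = lim (\<lambda>k. root k (real (card (A k))))"


section \<open>The graph and the probability measures\<close>

definition normal_form_graph :: "'a::monoid_mult \<Rightarrow> ('a, 'a \<times> 'a) pre_digraph"
  where "normal_form_graph \<Delta> =
    \<lparr> verts = proper_simples \<Delta>,
      arcs = {(s2, s1). s2 \<in> proper_simples \<Delta> \<and> s1 \<in> proper_simples \<Delta> \<and> compl \<Delta> s2 \<^bold>\<and> s1 = 1},
      tail = fst, head = snd \<rparr>"

definition \<nu> :: "'a::monoid_mult \<Rightarrow> nat \<Rightarrow> 'a pmf"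
  where "\<nu> \<Delta> k = pmf_of_set (layer \<Delta> k)"

definition \<mu>_atoms :: "'a::monoid_mult pmf"
  where "\<mu>_atoms = pmf_of_set monoid_atoms"

definition expected_pd :: "'a::monoid_mult \<Rightarrow> nat \<Rightarrow> real"
  where "expected_pd \<Delta> k =
    measure_pmf.expectation (pair_pmf (\<nu> \<Delta> k) \<mu>_atoms) (\<lambda>(x, a). real (pd \<Delta> x a))"

text \<open>
  The uniform distribution on an empty layer is meaningless (\<open>pmf_of_set {}\<close> is unspecified), so
  \<open>k\<close> tends to infinity through the indices with nonempty layer only.
\<close>

definition nonempty_layers :: "'a::monoid_mult \<Rightarrow> nat filter"
  where "nonempty_layers \<Delta> = inf sequentially (principal {k. layer \<Delta> k \<noteq> {}})"

end

theory Submission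
  imports Defs
begin

text \<open>
  Write \<open>H x = x \<^bold>\<and> \<Delta>\<close> for the head of \<open>x\<close>, \<open>g j\<close> for the number of elements of the layer \<open>j\<close> and
  \<open>p j\<close> for the number of penetration sequences of length \<open>j\<close>; let \<open>\<beta>\<close> and \<open>\<alpha>\<close> be the growth rates of \<open>g\<close>
  and \<open>p\<close>. As soon as the normal form graph has an arc, the expected penetration distance grows at least
  linearly in \<open>k\<close>, because every depth \<open>1 \<le> j \<le> k\<close> contributes at least a fixed positive amount to the
  expectation. Without arcs only finitely many layers are nonempty, and the limit is vacuous.

  Call a pair of \<open>y\<close> in the layer \<open>j\<close> and an atom \<open>a\<close> deep if \<open>H (y a) \<noteq> H y\<close> and \<open>\<Delta>\<close> does not divide
  \<open>y a\<close>. If the normal form of \<open>x\<close> ends in the normal form of \<open>y\<close>, then multiplying \<open>x\<close> by \<open>a\<close> changes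
  a letter at distance \<open>j\<close> from the end, so the penetration distance of \<open>x\<close> and \<open>a\<close> is at least \<open>j\<close>
  (\<open>pd_ge_of_deep\<close>). The expectation is therefore at least the sum over \<open>j\<close> of the probabilities that
  the last \<open>j\<close> letters of \<open>x\<close> form a deep pair with \<open>a\<close>.

  In a strongly connected graph with an arc the number of walks of length \<open>l\<close> that can be continued by a given
  vertex is comparable to the number of all walks of length \<open>l\<close>, uniformly in the vertex
  (\<open>walks_into_comparable\<close>): prolong a walk by a connecting walk and cut off as much in front. So each
  of these probabilities is, up to a constant, at least the number of deep pairs divided by \<open>g j\<close>.

  Both \<open>p\<close> and \<open>g\<close> are submultiplicative, since factors of penetration sequences and of normal forms
  are again such. By Fekete's argument the growth rates are limits, and \<open>\<alpha> ^ j \<le> p j\<close>. Strong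
  connectivity makes \<open>g\<close> supermultiplicative up to a constant \<open>K\<close> as well, hence \<open>g j \<le> K \<beta> ^ j\<close>.
  No subexponential factor is lost in either bound, so \<open>\<alpha> = \<beta>\<close> gives \<open>p (j + 1) \<ge> const \<cdot> g j\<close>.

  It remains to bound the number of deep pairs below by a multiple of \<open>p (j + 1)\<close>
  (\<open>card_penetration_seqs_le_deep_pairs\<close>). A penetration sequence of length \<open>j + 1\<close> may start with a
  simple element \<open>m\<close> that is not an atom. Dropping its leftmost letter leaves a sequence of length
  \<open>j\<close>, belonging to some \<open>x\<close> of the layer \<open>j\<close>, with \<open>H (x m) \<noteq> H x\<close> and \<open>H (x m) \<noteq> \<Delta>\<close>. When the atoms of
  \<open>m\<close> are multiplied to \<open>x\<close> one after the other, one of them must change the head, and it yields a deep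
  pair. The sequence can be recovered from that pair and two simple elements.
\<close>

section \<open>Growth rates of factor-closed languages\<close>

text \<open>
  Fekete's lemma in multiplicative form. If some \<open>n\<close>-th root is below \<open>t\<close>, then division with remainder
  by \<open>n\<close> bounds \<open>f k\<close> by \<open>C t ^ k\<close> for all \<open>k\<close>, and the constant disappears in the \<open>k\<close>-th root.
\<close>

lemma submult_root_convergent:
  fixes f :: "nat \<Rightarrow> real"
  assumes pos: "\<And>n. 0 \<le> f n" and sub: "\<And>m n. f (m + n) \<le> f m * f n"
  shows "convergent (\<lambda>n. root n (f n))"
proof -
  define L where "L = (INF n\<in>{1..}. root n (f n))"
  have bdd: "bdd_below ((\<lambda>n. root n (f n)) ` {1..})"
    using pos by (intro bdd_belowI[of _ 0]) auto
  have ge: "L \<le> root n (f n)" if "n \<ge> 1" for n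
    unfolding L_def using that bdd by (intro cINF_lower) auto
  have L0: "L \<ge> 0"
    unfolding L_def using pos by (intro cINF_greatest) auto
  have upper: "eventually (\<lambda>k. root k (f k) < u) sequentially" if u: "L < u" for u
  proof -
    define t where "t = (L + u) / 2"
    have t: "L < t" "t < u" "0 < t" using u L0 by (auto simp: t_def)
    obtain n where n: "n \<ge> 1" "root n (f n) < t"
      using cInf_lessD[of "(\<lambda>n. root n (f n)) ` {1..}" t] t(1) unfolding L_def by auto
    have fn: "f n \<le> t ^ n"
    proof -
      have "f n = root n (f n) ^ n" using n pos by simp
      also have "\<dots> \<le> t ^ n" using n pos by (intro power_mono) auto
      finally show ?thesis .
    qed
    define C where "C = (\<Sum>r<n. f r / t ^ r) + 1"
    have Cpos: "C > 0" unfolding C_def using pos t by (intro add_nonneg_pos sum_nonneg) auto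
    have mult: "f (q * n + r) \<le> (t ^ n) ^ q * f r" for q r
    proof (induction q)
      case (Suc q)
      have "f (Suc q * n + r) \<le> f n * f (q * n + r)"
        using sub[of n "q * n + r"] by (simp add: algebra_simps)
      also have "\<dots> \<le> t ^ n * ((t ^ n) ^ q * f r)"
        using Suc fn pos t by (intro mult_mono) auto
      finally show ?case by (simp add: algebra_simps)
    qed auto
    have bound: "f k \<le> C * t ^ k" for k
    proof -
      define q r where "q = k div n" and "r = k mod n"
      have k: "k = q * n + r" and r: "r < n" using n by (auto simp: q_def r_def)
      have "f k \<le> (t ^ n) ^ q * f r" using mult k by simp
      also have "\<dots> = t ^ k * (f r / t ^ r)"
        using t by (simp add: k power_add power_mult[symmetric] mult.commute)
      also have "\<dots> \<le> t ^ k * C"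
      proof (intro mult_left_mono)
        have "f r / t ^ r \<le> (\<Sum>r<n. f r / t ^ r)"
          using r pos t by (intro member_le_sum) auto
        then show "f r / t ^ r \<le> C" by (simp add: C_def)
      qed (use t in auto)
      finally show ?thesis by (simp add: mult.commute)
    qed
    have "(\<lambda>k. root k C * t) \<longlonglongrightarrow> 1 * t"
      using Cpos by (intro tendsto_intros LIMSEQ_root_const)
    then have "eventually (\<lambda>k. root k C * t < u) sequentially"
      using t by (intro order_tendstoD) auto
    then show ?thesis
      using eventually_gt_at_top[of 0]
    proof eventually_elim
      case (elim k)
      have "root k (f k) \<le> root k (C * t ^ k)"
        using elim bound by simp
      also have "\<dots> = root k C * t"
        using elim t by (simp add: real_root_mult real_root_power_cancel)
      finally show ?case using elim by simp
    qed
  qed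
  have "(\<lambda>k. root k (f k)) \<longlonglongrightarrow> L"
  proof (rule order_tendstoI)
    fix a assume "a < L"
    show "eventually (\<lambda>k. a < root k (f k)) sequentially"
      using eventually_ge_at_top[of 1]
      by eventually_elim (use ge \<open>a < L\<close> in \<open>auto intro: less_le_trans\<close>)
  qed (use upper in auto)
  then show ?thesis by (rule convergentI)
qed

text \<open>
  Closure under prefixes and suffixes is what submultiplicativity needs; by iteration it is closure
  under all factors.
\<close>

definition factor_closed :: "(nat \<Rightarrow> 'b list set) \<Rightarrow> bool"
  where "factor_closed F \<longleftrightarrow>
    (\<forall>k. finite (F k)) \<and>
    (\<forall>j l. \<forall>w \<in> F (j + l). take j w \<in> F j \<and> drop j w \<in> F l)"

lemma factor_closed_card:
  assumes "factor_closed F"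
  shows "card (F (j + l)) \<le> card (F j) * card (F l)"
proof -
  have "card (F (j + l)) \<le> card (F j \<times> F l)"
  proof (rule card_inj_on_le)
    show "inj_on (\<lambda>w. (take j w, drop j w)) (F (j + l))"
      by (rule inj_onI) (metis append_take_drop_id prod.inject)
  qed (use assms in \<open>auto simp: factor_closed_def\<close>)
  then show ?thesis by (simp add: card_cartesian_product)
qed

lemma growth_rate_tendsto:
  assumes "factor_closed F"
  shows "(\<lambda>k. root k (real (card (F k)))) \<longlonglongrightarrow> growth_rate F"
  unfolding growth_rate_def convergent_LIMSEQ_iff[symmetric]
proof (rule submult_root_convergent)
  show "real (card (F (m + n))) \<le> real (card (F m)) * real (card (F n))" for m n
    using factor_closed_card[OF assms] by (metis of_nat_le_iff of_nat_mult)
qed auto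

lemma growth_rate_subseq:
  assumes F: "factor_closed F" and j: "j \<ge> 1"
  shows "(\<lambda>n. root n (real (card (F (n * j))))) \<longlonglongrightarrow> growth_rate F ^ j"
proof -
  have sub: "filterlim (\<lambda>n. n * j) at_top sequentially"
    using j by (intro filterlim_subseq) (auto simp: strict_mono_def)
  have "(\<lambda>n. root (n * j) (real (card (F (n * j)))) ^ j) \<longlonglongrightarrow> growth_rate F ^ j"
    by (intro tendsto_power filterlim_compose[OF growth_rate_tendsto[OF F] sub])
  moreover have "root (n * j) x ^ j = root n x" if "x \<ge> 0" for n and x :: real
    using real_root_pow_pos2[of j "root n x"] real_root_ge_zero[of x n] that j real_root_mult_exp[of j n x]
    by (simp add: mult.commute)
  ultimately show ?thesis by simp
qed

text \<open>
  Submultiplicativity gives \<open>f (n j) \<le> f j ^ n\<close>. In the \<open>n\<close>-th root the left side tends to the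
  \<open>j\<close>-th power of the growth rate, which is therefore a lower bound without any constant.
\<close>

lemma growth_rate_power_le:
  assumes F: "factor_closed F" and j: "j \<ge> 1"
  shows "growth_rate F ^ j \<le> real (card (F j))"
proof (rule LIMSEQ_le_const2[OF growth_rate_subseq[OF F j]], intro exI allI impI)
  fix n :: nat assume n: "1 \<le> n"
  have pw: "card (F (n * j)) \<le> card (F j) ^ n" if "n \<ge> 1" for n
    using that
  proof (induction n rule: dec_induct)
    case (step n)
    then show ?case
      using factor_closed_card[OF F, of j "n * j"] by (auto intro: order_trans)
  qed simp
  have "root n (real (card (F (n * j)))) \<le> root n (real (card (F j)) ^ n)"
    using n pw[OF n] by (simp add: of_nat_power[symmetric] del: of_nat_power)
  also have "\<dots> = real (card (F j))"
    using n by (simp add: real_root_power_cancel)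
  finally show "root n (real (card (F (n * j)))) \<le> real (card (F j))" .
qed

text \<open>
  The dual bound: iterating the supermultiplicativity \<open>n\<close> times costs \<open>K ^ n\<close>, hence only one factor
  \<open>K\<close> after taking the \<open>n\<close>-th root.
\<close>

lemma card_le_growth_rate_power:
  assumes F: "factor_closed F" and j: "j \<ge> 1"
    and super: "\<And>j l. card (F j) * card (F l) \<le> K * card (F (j + l))"
  shows "real (card (F j)) \<le> K * growth_rate F ^ j"
proof (rule LIMSEQ_le_const[OF tendsto_mult_left[OF growth_rate_subseq[OF F j]]], intro exI allI impI)
  fix n :: nat assume n: "1 \<le> n"
  have pw: "card (F j) ^ n \<le> K ^ (n - 1) * card (F (n * j))" if "n \<ge> 1" for n
    using that
  proof (induction n rule: dec_induct)
    case (step n)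
    have "card (F j) ^ Suc n \<le> card (F j) * (K ^ (n - 1) * card (F (n * j)))"
      using step by simp
    also have "\<dots> = K ^ (n - 1) * (card (F j) * card (F (n * j)))" by simp
    also have "\<dots> \<le> K ^ (n - 1) * (K * card (F (j + n * j)))"
      by (intro mult_left_mono super) auto
    also have "\<dots> = K ^ (Suc n - 1) * card (F (Suc n * j))"
      using step by (cases n) auto
    finally show ?case .
  qed simp
  show "real (card (F j)) \<le> real K * root n (real (card (F (n * j))))"
  proof (cases "K = 0")
    case True
    then show ?thesis using super[of j j] by simp
  next
    case False
    have "card (F j) ^ n \<le> K ^ n * card (F (n * j))"
      using pw[OF n] False order_trans[OF _ mult_le_mono1[OF power_increasing[of "n - 1" n K]]]
      by simp
    then have "real (card (F j)) ^ n \<le> real K ^ n * real (card (F (n * j)))"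
      by (metis of_nat_le_iff of_nat_mult of_nat_power)
    then have "root n (real (card (F j)) ^ n) \<le> root n (real K ^ n * real (card (F (n * j))))"
      using n by simp
    then show ?thesis
      using n by (simp add: real_root_mult real_root_power_cancel)
  qed
qed

section \<open>Walks in a finite graph\<close>

definition walks :: "'b set \<Rightarrow> ('b \<Rightarrow> 'b \<Rightarrow> bool) \<Rightarrow> nat \<Rightarrow> 'b list set"
  where "walks V E k = {w. length w = k \<and> set w \<subseteq> V \<and> successively E w}"

lemma finite_walks: "finite V \<Longrightarrow> finite (walks V E k)"
  by (rule finite_subset[OF _ finite_lists_length_eq[of V k]]) (auto simp: walks_def)

lemma successively_takeI: "successively P w \<Longrightarrow> successively P (take n w)"
  and successively_dropI: "successively P w \<Longrightarrow> successively P (drop n w)"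
  by (metis append_take_drop_id successively_append_iff)+

lemma factor_closed_walks: "finite V \<Longrightarrow> factor_closed (walks V E)"
  unfolding factor_closed_def
  by (auto simp: finite_walks)
     (auto simp: walks_def successively_takeI successively_dropI dest: in_set_takeD in_set_dropD)

text \<open>
  The last letter is constrained through \<open>u @ [v]\<close> so that the empty walk leads into every vertex.
\<close>

definition walks_into :: "'b set \<Rightarrow> ('b \<Rightarrow> 'b \<Rightarrow> bool) \<Rightarrow> nat \<Rightarrow> 'b \<Rightarrow> 'b list set"
  where "walks_into V E l v = {u \<in> walks V E l. successively E (u @ [v])}"

lemma finite_connecting_walks:
  assumes fin: "finite V"
    and conn: "\<And>u v. u \<in> V \<Longrightarrow> v \<in> V \<Longrightarrow> \<exists>c. set c \<subseteq> V \<and> successively E (u # c @ [v])"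
  obtains N where
    "\<And>u v. u \<in> V \<Longrightarrow> v \<in> V \<Longrightarrow> \<exists>c. set c \<subseteq> V \<and> length c \<le> N \<and> successively E (u # c @ [v])"
proof -
  obtain c where c: "\<And>u v. u \<in> V \<Longrightarrow> v \<in> V \<Longrightarrow> set (c u v) \<subseteq> V \<and> successively E (u # c u v @ [v])"
    using conn by metis
  have "length (c u v) \<le> Max ((\<lambda>(u, v). length (c u v)) ` (V \<times> V))" if "u \<in> V" "v \<in> V" for u v
    using fin that by (intro Max_ge) auto
  then show thesis using c that by blast
qed

text \<open>
  A walk of length \<open>l\<close> is prolonged by a connecting walk of bounded length until \<open>v\<close> can follow, and
  its first letters are cut off to restore the length. The letters that are cut off form one of finitely many
  words, and together with the result they determine the original walk; so \<open>K\<close> depends neither on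
  \<open>l\<close> nor on \<open>v\<close>.
\<close>

lemma walks_into_comparable:
  assumes fin: "finite V"
    and conn: "\<And>u v. u \<in> V \<Longrightarrow> v \<in> V \<Longrightarrow> \<exists>c. set c \<subseteq> V \<and> successively E (u # c @ [v])"
  obtains K where "K > 0"
    "\<And>l v. v \<in> V \<Longrightarrow> card (walks V E l) \<le> K * card (walks_into V E l v)"
proof -
  obtain N where N:
    "\<And>u v. u \<in> V \<Longrightarrow> v \<in> V \<Longrightarrow> \<exists>c. set c \<subseteq> V \<and> length c \<le> N \<and> successively E (u # c @ [v])"
    using finite_connecting_walks[OF assms] by metis
  define R where "R = {r. set r \<subseteq> V \<and> length r \<le> N}"
  have finR: "finite R" unfolding R_def by (rule finite_lists_length_le[OF fin])
  have R: "card R > 0"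
    using finR by (auto simp: R_def card_gt_0_iff intro!: exI[of _ "[]"])
  have "card (walks V E l) \<le> card R * card (walks_into V E l v)" if v: "v \<in> V" for l v
  proof -
    have "\<exists>c \<in> R. successively E (p @ c @ [v])" if p: "p \<in> walks V E l" for p
    proof (cases "p = []")
      case True
      then show ?thesis by (intro bexI[of _ "[]"]) (simp_all add: R_def)
    next
      case False
      then have "last p \<in> V" using p by (auto simp: walks_def)
      then obtain c where "set c \<subseteq> V" "length c \<le> N" "successively E (last p # c @ [v])"
        using N v by meson
      then show ?thesis
        using p False by (auto simp: walks_def R_def successively_append_iff successively_Cons intro!: bexI[of _ c])
    qed
    then obtain c where c: "\<And>p. p \<in> walks V E l \<Longrightarrow> c p \<in> R \<and> successively E (p @ c p @ [v])"
      by metis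
    define \<phi> where "\<phi> p = (take (length (c p)) (p @ c p), drop (length (c p)) (p @ c p))" for p
    have "inj_on \<phi> (walks V E l)"
    proof (rule inj_onI)
      fix p q assume p: "p \<in> walks V E l" and q: "q \<in> walks V E l" and eq: "\<phi> p = \<phi> q"
      have "p @ c p = q @ c q"
        using eq by (metis \<phi>_def append_take_drop_id prod.inject)
      then show "p = q" using p q by (auto simp: walks_def)
    qed
    moreover have "\<phi> ` walks V E l \<subseteq> R \<times> walks_into V E l v"
    proof (rule image_subsetI)
      fix p assume p: "p \<in> walks V E l"
      have sub: "set (p @ c p) \<subseteq> V" using c[OF p] p by (auto simp: R_def walks_def)
      have "successively E (drop (length (c p)) (p @ c p @ [v]))"
        using c[OF p] by (intro successively_dropI) auto
      moreover have "drop (length (c p)) (p @ c p @ [v]) = drop (length (c p)) (p @ c p) @ [v]"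
        by simp
      ultimately have suc: "successively E (drop (length (c p)) (p @ c p) @ [v])" by simp
      then have "drop (length (c p)) (p @ c p) \<in> walks_into V E l v"
        using p sub unfolding walks_into_def walks_def
        by (auto simp: successively_append_iff[of E _ "[v]"] simp del: drop_append set_append dest!: in_set_dropD)
      moreover have "take (length (c p)) (p @ c p) \<in> R"
        using c[OF p] sub unfolding R_def
        by (auto simp del: take_append set_append dest!: in_set_takeD)
      ultimately show "\<phi> p \<in> R \<times> walks_into V E l v" by (simp add: \<phi>_def)
    qed
    moreover have "finite (walks_into V E l v)"
      using finite_walks[OF fin] by (auto simp: walks_into_def)
    ultimately show ?thesis
      using card_inj_on_le[of \<phi> "walks V E l" "R \<times> walks_into V E l v"] finR
      by (simp add: card_cartesian_product)
  qed
  then show thesis using R that by blast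
qed

text \<open>
  The walks of length \<open>l + j\<close> whose last \<open>j\<close> letters are prescribed are counted by the walks that
  lead into the first of these letters. The second component of \<open>Y\<close> is carried along because the
  prescribed suffixes will be weighted by the atoms that belong to them.
\<close>

lemma card_prolonged_walks:
  assumes fin: "finite V" and Y: "Y \<subseteq> walks V E j \<times> A" and finA: "finite A" and j: "j \<ge> 1"
    and K: "\<And>v. v \<in> V \<Longrightarrow> card (walks V E l) \<le> K * card (walks_into V E l v)"
  shows "card Y * card (walks V E l) \<le>
    K * card {(w, a) \<in> walks V E (l + j) \<times> A. (drop l w, a) \<in> Y}"
proof -
  let ?S = "SIGMA p:Y. walks_into V E l (hd (fst p))"
  have finY: "finite Y" using Y finite_walks[OF fin] finA finite_subset by blast
  have hd: "hd (fst p) \<in> V" if "p \<in> Y" for p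
    using that Y j by (cases "fst p") (auto simp: walks_def)
  have fw: "finite (walks_into V E l v)" for v
    using finite_walks[OF fin] by (auto simp: walks_into_def)
  have "card Y * card (walks V E l) \<le> (\<Sum>p\<in>Y. K * card (walks_into V E l (hd (fst p))))"
    using sum_mono[of Y "\<lambda>_. card (walks V E l)"] K hd by simp
  also have "\<dots> = K * card ?S"
    using finY fw by (simp add: card_SigmaI sum_distrib_left)
  also have "card ?S \<le> card {(w, a) \<in> walks V E (l + j) \<times> A. (drop l w, a) \<in> Y}"
  proof (rule card_inj_on_le[where f = "\<lambda>((y, a), u). (u @ y, a)"])
    show "inj_on (\<lambda>((y, a), u). (u @ y, a)) ?S"
    proof (rule inj_onI)
      fix p q assume p: "p \<in> ?S" and q: "q \<in> ?S"
        and eq: "(\<lambda>((y, a), u). (u @ y, a)) p = (\<lambda>((y, a), u). (u @ y, a)) q"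
      have "length (snd p) = l" "length (snd q) = l"
        using p q by (auto simp: walks_into_def walks_def)
      then show "p = q" using eq by (auto simp: case_prod_beta prod_eq_iff)
    qed
    have "(u @ y, a) \<in> walks V E (l + j) \<times> A \<and> (drop l (u @ y), a) \<in> Y"
      if "(y, a) \<in> Y" "u \<in> walks_into V E l (hd y)" for y a u
    proof -
      have "y \<noteq> []" "length u = l" using that Y j by (auto simp: walks_def walks_into_def)
      then show ?thesis
        using that Y by (auto simp: walks_into_def walks_def successively_append_iff)
    qed
    then show "(\<lambda>((y, a), u). (u @ y, a)) ` ?S \<subseteq> {(w, a) \<in> walks V E (l + j) \<times> A. (drop l w, a) \<in> Y}"
      by fastforce
    show "finite {(w, a) \<in> walks V E (l + j) \<times> A. (drop l w, a) \<in> Y}"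
      by (rule finite_subset[of _ "walks V E (l + j) \<times> A"]) (use finite_walks[OF fin] finA in auto)
  qed
  finally show ?thesis by simp
qed

lemma card_walks_supermult:
  assumes fin: "finite V"
    and K: "\<And>l v. v \<in> V \<Longrightarrow> card (walks V E l) \<le> K * card (walks_into V E l v)" and "K > 0"
  shows "card (walks V E j) * card (walks V E l) \<le> K * card (walks V E (j + l))"
proof (cases "j = 0")
  case True
  then have "walks V E j = {[]}" by (auto simp: walks_def)
  then show ?thesis using True \<open>K > 0\<close> by simp
next
  case False
  let ?Y = "walks V E j \<times> {()}"
  have "card ?Y * card (walks V E l) \<le> K * card {(w, a) \<in> walks V E (l + j) \<times> {()}. (drop l w, a) \<in> ?Y}"
    by (rule card_prolonged_walks) (use assms False in auto)
  also have "\<dots> \<le> K * card (walks V E (l + j) \<times> {()})"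
    by (intro mult_left_mono card_mono) (auto simp: finite_walks fin)
  finally show ?thesis by (simp add: card_cartesian_product add.commute)
qed

text \<open>
  The transitive closure, not the reflexive one, is used: walks must be joined through an honest
  walk of at least one arc even if both ends agree.
\<close>

lemma in_trancl_imp_successively:
  assumes "(u, v) \<in> {(s, t). s \<in> V \<and> t \<in> V \<and> E s t}\<^sup>+"
  shows "\<exists>c. set c \<subseteq> V \<and> successively E (u # c @ [v])"
  using assms
proof (induction rule: trancl_induct)
  case (base v)
  then show ?case by (intro exI[of _ "[]"]) auto
next
  case (step v t)
  then obtain c where "set c \<subseteq> V" "successively E (u # c @ [v])" by blast
  then have "successively E ((u # c @ [v]) @ [t])" "set (c @ [v]) \<subseteq> V"
    using step unfolding successively_append_iff by auto
  then show ?case by (intro exI[of _ "c @ [v]"]) simp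
qed

section \<open>Greedy words\<close>

text \<open>
  The condition on the letters of a left normal form, as a property of the word alone, so that it can
  be used in inductions on words.
\<close>

definition greedy :: "'a::monoid_mult \<Rightarrow> 'a list \<Rightarrow> bool"
  where "greedy \<Delta> xs \<longleftrightarrow>
    set xs \<subseteq> simples \<Delta> - {1} \<and> successively (\<lambda>s t. compl \<Delta> s \<^bold>\<and> t = 1) xs"

lemma is_left_normal_form_iff_greedy:
  "is_left_normal_form \<Delta> x xs \<longleftrightarrow> prod_list xs = x \<and> greedy \<Delta> xs"
  by (auto simp: is_left_normal_form_def greedy_def successively_conv_nth)

lemma greedy_Nil [simp]: "greedy \<Delta> []"
  and greedy_Cons: "greedy \<Delta> (s # xs) \<longleftrightarrow>
    s \<in> simples \<Delta> \<and> s \<noteq> 1 \<and> (xs \<noteq> [] \<longrightarrow> compl \<Delta> s \<^bold>\<and> hd xs = 1) \<and> greedy \<Delta> xs"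
  by (cases xs; auto simp: greedy_def)+

section \<open>Divisibility and quasi-centrality in a Garside monoid\<close>

lemma left_dvdE:
  assumes "x \<preceq> y" obtains c where "y = x * c"
  using assms by (auto simp: left_dvd_def)

lemma left_dvd_mult [simp]: "x \<preceq> x * y"
  by (auto simp: left_dvd_def)

lemma one_left_dvd [simp]: "1 \<preceq> x"
  by (auto simp: left_dvd_def)

lemma left_dvd_refl [simp]: "x \<preceq> x"
  by (auto simp: left_dvd_def intro: exI[of _ 1])

lemma left_dvd_trans [trans]: "x \<preceq> y \<Longrightarrow> y \<preceq> z \<Longrightarrow> x \<preceq> z"
  by (auto simp: left_dvd_def mult.assoc)

lemma left_dvd_mult_right: "x \<preceq> y \<Longrightarrow> x \<preceq> y * z"
  by (auto simp: left_dvd_def mult.assoc)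

context garside_monoid
begin

lemma left_dvd_antisym: "x \<preceq> y \<Longrightarrow> y \<preceq> x \<Longrightarrow> x = (y::'a)"
proof -
  obtain meet join :: "'a \<Rightarrow> 'a \<Rightarrow> 'a" where
    L: "class.lattice meet (\<lambda>x y. x \<preceq> y) (\<lambda>x y. x \<preceq> y \<and> x \<noteq> y) join"
    using left_lattice by blast
  interpret L: lattice meet "\<lambda>x y. x \<preceq> y" "\<lambda>x y. x \<preceq> y \<and> x \<noteq> y" join by (rule L)
  show "x \<preceq> y \<Longrightarrow> y \<preceq> x \<Longrightarrow> x = y" by (rule L.order_antisym)
qed

lemma left_dvd_gcd_iff: "d \<preceq> x \<^bold>\<and> y \<longleftrightarrow> d \<preceq> x \<and> d \<preceq> (y::'a)"
proof -
  obtain meet join :: "'a \<Rightarrow> 'a \<Rightarrow> 'a" where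
    L: "class.lattice meet (\<lambda>x y. x \<preceq> y) (\<lambda>x y. x \<preceq> y \<and> x \<noteq> y) join"
    using left_lattice by blast
  interpret L: lattice meet "\<lambda>x y. x \<preceq> y" "\<lambda>x y. x \<preceq> y \<and> x \<noteq> y" join by (rule L)
  have "x \<^bold>\<and> y = meet x y"
    unfolding left_gcd_def
    by (rule the_equality) (auto intro: left_dvd_antisym)
  then show ?thesis by (simp add: L.le_inf_iff)
qed

lemma gcd_left_dvd [simp]: "x \<^bold>\<and> y \<preceq> x" "x \<^bold>\<and> y \<preceq> (y::'a)"
  using left_dvd_gcd_iff[of "x \<^bold>\<and> y" x y] by auto

lemma left_gcd_eqI:
  "d \<preceq> x \<Longrightarrow> d \<preceq> y \<Longrightarrow> (\<And>e. e \<preceq> x \<Longrightarrow> e \<preceq> y \<Longrightarrow> e \<preceq> d) \<Longrightarrow> x \<^bold>\<and> y = (d::'a)"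
  by (simp add: left_dvd_antisym left_dvd_gcd_iff)

lemma left_gcd_commute: "x \<^bold>\<and> y = y \<^bold>\<and> (x::'a)"
  by (simp add: left_gcd_eqI left_dvd_gcd_iff)

lemma left_gcd_absorb: "x \<preceq> y \<Longrightarrow> x \<^bold>\<and> y = (x::'a)"
  by (rule left_gcd_eqI) auto

lemma left_dvd_one_iff [simp]: "x \<preceq> 1 \<longleftrightarrow> x = (1::'a)"
  using left_dvd_antisym[of x 1] by auto

lemma left_dvd_cancel [simp]: "c * x \<preceq> c * y \<longleftrightarrow> x \<preceq> (y::'a)"
  by (metis left_cancel left_dvd_def mult.assoc)

text \<open>
  Left multiplication by \<open>c\<close> is an order isomorphism onto the multiples of \<open>c\<close>, and the gcd of two
  multiples of \<open>c\<close> is itself a multiple of \<open>c\<close>.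
\<close>

lemma left_gcd_mult_left: "(c * x) \<^bold>\<and> (c * y) = c * (x \<^bold>\<and> (y::'a))"
proof (rule left_gcd_eqI)
  fix e assume e: "e \<preceq> c * x" "e \<preceq> c * y"
  have "c \<preceq> (c * x) \<^bold>\<and> (c * y)" by (simp add: left_dvd_gcd_iff)
  then obtain d where d: "(c * x) \<^bold>\<and> (c * y) = c * d" by (rule left_dvdE)
  have "d \<preceq> x" "d \<preceq> y" using d gcd_left_dvd[of "c * x" "c * y"] by simp_all
  then have "c * d \<preceq> c * (x \<^bold>\<and> y)" by (simp add: left_dvd_gcd_iff)
  then show "e \<preceq> c * (x \<^bold>\<and> y)" using e d left_dvd_gcd_iff left_dvd_trans by metis
qed auto

lemma one_left_gcd [simp]: "1 \<^bold>\<and> x = (1::'a)" "x \<^bold>\<and> 1 = (1::'a)"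
  by (auto intro: left_gcd_eqI)

lemma mult_compl: "s \<in> simples \<Delta> \<Longrightarrow> s * compl \<Delta> s = \<Delta>"
  unfolding compl_def simples_def
  by (rule theI') (auto simp: left_dvd_def dest: left_cancel)

lemma simples_iff_right: "s \<in> simples \<Delta> \<longleftrightarrow> \<Delta> \<succeq> s"
  using left_right_simples by (auto simp: simples_def)

lemma compl_simple: "s \<in> simples \<Delta> \<Longrightarrow> compl \<Delta> s \<in> simples \<Delta>"
  by (metis mult_compl right_mult_def simples_iff_right)

lemma simple_left_dvd: "s \<in> simples \<Delta> \<Longrightarrow> t \<preceq> s \<Longrightarrow> t \<in> simples \<Delta>"
  by (auto simp: simples_def intro: left_dvd_trans)

lemma one_simple [simp]: "1 \<in> simples \<Delta>" and Delta_simple [simp]: "\<Delta> \<in> simples \<Delta>"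
  by (auto simp: simples_def)

lemma compl_Delta [simp]: "compl \<Delta> \<Delta> = 1"
  using mult_compl[of \<Delta>] left_cancel[of \<Delta> "compl \<Delta> \<Delta>" 1] by simp

lemma simples_induct [case_names one mult]:
  assumes "P 1" and "\<And>s x. s \<in> simples \<Delta> \<Longrightarrow> P x \<Longrightarrow> P (s * x)"
  shows "P (x::'a)"
proof -
  obtain xs where "set xs \<subseteq> simples \<Delta>" "prod_list xs = x" using simples_generate by blast
  moreover have "set xs \<subseteq> simples \<Delta> \<Longrightarrow> P (prod_list xs)"
    by (induction xs) (auto intro: assms)
  ultimately show ?thesis by blast
qed

text \<open>
  For a simple \<open>s\<close> one has \<open>s \<Delta> = s (\<partial>s) (\<partial>\<partial>s) = \<Delta> (\<partial>\<partial>s)\<close>, and the simple elements generate.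
\<close>

lemma Delta_quasi_central_right: "\<exists>y. x * \<Delta> = \<Delta> * (y::'a)"
proof (induction x rule: simples_induct)
  case one
  then show ?case by (auto intro: exI[of _ 1])
next
  case (mult s x)
  then obtain y where y: "x * \<Delta> = \<Delta> * y" by blast
  have "s * \<Delta> = s * (compl \<Delta> s * compl \<Delta> (compl \<Delta> s))"
    using mult by (simp add: mult_compl compl_simple)
  also have "\<dots> = \<Delta> * compl \<Delta> (compl \<Delta> s)"
    using mult by (simp add: mult_compl mult.assoc[symmetric])
  finally show ?case using y by (metis mult.assoc)
qed

text \<open>
  The mirror image of the previous argument. It uses that left and right divisors of \<open>\<Delta>\<close> coincide:
  \<open>\<Delta> = t s = u t\<close> gives \<open>\<Delta> s = u t s = u \<Delta>\<close>.
\<close>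

lemma Delta_quasi_central_left: "\<exists>y. \<Delta> * x = (y::'a) * \<Delta>"
proof (induction x rule: simples_induct)
  case one
  then show ?case by (auto intro: exI[of _ 1])
next
  case (mult s x)
  then obtain y where y: "\<Delta> * x = y * \<Delta>" by blast
  obtain t where t: "\<Delta> = t * s" using mult simples_iff_right by (auto simp: right_mult_def)
  then have "t \<in> simples \<Delta>" by (auto simp: simples_def)
  then obtain u where u: "\<Delta> = u * t" using simples_iff_right by (auto simp: right_mult_def)
  have "\<Delta> * s = u * \<Delta>" using t u by (metis mult.assoc)
  then show ?case using y by (metis mult.assoc)
qed

lemma Delta_power_quasi_central_right: "\<exists>y. x * \<Delta> ^ n = \<Delta> ^ n * (y::'a)"
proof (induction n arbitrary: x)
  case (Suc n)
  obtain y where y: "x * \<Delta> = \<Delta> * y" using Delta_quasi_central_right by blast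
  obtain z where z: "y * \<Delta> ^ n = \<Delta> ^ n * z" using Suc by blast
  have "x * \<Delta> ^ Suc n = \<Delta> * (y * \<Delta> ^ n)" using y by (simp add: mult.assoc[symmetric])
  also have "\<dots> = \<Delta> ^ Suc n * z" using z by (simp add: mult.assoc)
  finally show ?case by blast
qed auto

lemma Delta_power_quasi_central_left: "\<exists>y. \<Delta> ^ n * x = (y::'a) * \<Delta> ^ n"
proof (induction n arbitrary: x)
  case (Suc n)
  obtain y where y: "\<Delta> ^ n * x = y * \<Delta> ^ n" using Suc by blast
  obtain z where z: "\<Delta> * y = z * \<Delta>" using Delta_quasi_central_left by blast
  have "\<Delta> ^ Suc n * x = (\<Delta> * y) * \<Delta> ^ n" using y by (simp add: mult.assoc)
  also have "\<dots> = z * \<Delta> ^ Suc n" using z by (simp add: mult.assoc)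
  finally show ?case by blast
qed auto

lemma Delta_power_left_dvd_mult: "\<Delta> ^ n \<preceq> (x::'a) * \<Delta> ^ n"
  using Delta_power_quasi_central_right[of x n] by auto

lemma Delta_power_mono: "m \<le> n \<Longrightarrow> \<Delta> ^ m \<preceq> \<Delta> ^ n"
  by (metis le_add_diff_inverse left_dvd_mult power_add)

lemma Delta_left_dvd_mult_left: "\<Delta> \<preceq> x \<Longrightarrow> \<Delta> \<preceq> y * (x::'a)"
proof -
  assume "\<Delta> \<preceq> x"
  then obtain c where "x = \<Delta> * c" by (auto simp: left_dvd_def)
  moreover obtain z where "y * \<Delta> = \<Delta> * z" using Delta_quasi_central_right by blast
  ultimately have "y * x = \<Delta> * (z * c)" by (metis mult.assoc)
  then show ?thesis by simp
qed

lemma right_divisor_Delta_power: "\<exists>n y. (y::'a) * x = \<Delta> ^ n"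
proof (induction x rule: simples_induct)
  case one
  then show ?case by (auto intro: exI[of _ 0])
next
  case (mult s x)
  then obtain n y where y: "y * x = \<Delta> ^ n" by blast
  obtain t where t: "\<Delta> = t * s" using mult simples_iff_right by (auto simp: right_mult_def)
  obtain z where z: "\<Delta> * y = z * \<Delta>" using Delta_quasi_central_left by blast
  have "(z * t) * (s * x) = z * (t * s) * x" by (simp add: mult.assoc)
  also have "\<dots> = \<Delta> * y * x" using t z by simp
  also have "\<dots> = \<Delta> ^ Suc n" using y by (simp add: mult.assoc)
  finally show ?case by blast
qed

text \<open>
  Right divisors of \<open>\<Delta> ^ n\<close> are left divisors, by quasi-centrality.
\<close>

lemma left_dvd_Delta_powerI:
  assumes "k * d = \<Delta> ^ n" shows "(d::'a) \<preceq> \<Delta> ^ n"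
proof -
  obtain y where "k * \<Delta> ^ n = \<Delta> ^ n * y" using Delta_power_quasi_central_right by blast
  then have "k * \<Delta> ^ n = k * (d * y)" using assms by (simp add: mult.assoc[symmetric])
  then have "\<Delta> ^ n = d * y" by (rule left_cancel)
  then show ?thesis by simp
qed

text \<open>
  This is what makes the gcd with powers of \<open>\<Delta>\<close> computable. In the group of fractions,
  \<open>c \<Delta> ^ n = d g\<close> says that \<open>c\<^sup>-\<^sup>1 d = \<Delta> ^ n g\<^sup>-\<^sup>1 = g'\<^sup>-\<^sup>1 \<Delta> ^ n\<close>, where \<open>g'\<close> is the conjugate of \<open>g\<close>. The first
  fraction is in lowest terms, so the last one is an expansion of it: \<open>\<Delta> ^ n = k d\<close> for some \<open>k\<close>. Thus \<open>d\<close> is a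
  right divisor of \<open>\<Delta> ^ n\<close>, hence a left divisor. The proof stays in the monoid by clearing
  denominators with powers of \<open>\<Delta>\<close>.
\<close>

lemma left_dvd_Delta_power_of_coprime:
  assumes cd: "c \<^bold>\<and> d = 1" and d: "d \<preceq> c * \<Delta> ^ n"
  shows "(d::'a) \<preceq> \<Delta> ^ n"
proof -
  obtain g where g: "c * \<Delta> ^ n = d * g" using d by (rule left_dvdE)
  obtain g' where g': "\<Delta> ^ n * g = g' * \<Delta> ^ n" using Delta_power_quasi_central_left by blast
  obtain P N where P: "P * c = \<Delta> ^ N" using right_divisor_Delta_power by blast
  obtain q M where q: "q * g' = \<Delta> ^ M" using right_divisor_Delta_power by blast
  \<comment> \<open>\<open>p'\<close> and \<open>q'\<close> witness the equality of the fractions \<open>c\<^sup>-\<^sup>1 d\<close> and \<open>g'\<^sup>-\<^sup>1 \<Delta> ^ n\<close>\<close>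
  define p' q' where "p' = \<Delta> ^ M * P" and "q' = \<Delta> ^ N * q"
  have pq: "p' * c = q' * g'"
    by (simp add: p'_def q'_def mult.assoc P q power_add[symmetric] add.commute)
  have "p' * d * g = p' * c * \<Delta> ^ n" using g by (simp add: mult.assoc)
  also have "\<dots> = q' * \<Delta> ^ n * g" using pq g' by (simp add: mult.assoc)
  finally have pd: "p' * d = q' * \<Delta> ^ n" by (rule right_cancel)
  have "q' \<preceq> (p' * c) \<^bold>\<and> (p' * d)" using pq pd by (simp add: left_dvd_gcd_iff)
  then have "q' \<preceq> p'" using cd by (simp add: left_gcd_mult_left)
  then obtain k where k: "p' = q' * k" by (auto simp: left_dvd_def)
  have "q' * (k * d) = q' * \<Delta> ^ n" using pd k by (simp add: mult.assoc)
  then have "k * d = \<Delta> ^ n" by (rule left_cancel)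
  then show ?thesis by (rule left_dvd_Delta_powerI)
qed

lemma simple_mult_left_dvd_Delta_power:
  assumes "s \<in> simples \<Delta>" "x \<preceq> \<Delta> ^ n" shows "s * x \<preceq> \<Delta> ^ Suc n"
proof -
  have "\<Delta> ^ Suc n = s * (compl \<Delta> s * \<Delta> ^ n)"
    using mult_compl[OF assms(1)] by (simp add: mult.assoc[symmetric])
  moreover have "x \<preceq> compl \<Delta> s * \<Delta> ^ n"
    using assms(2) Delta_power_left_dvd_mult by (rule left_dvd_trans)
  ultimately show ?thesis by simp
qed

lemma mult_simple_left_dvd_Delta_power:
  assumes u: "u \<preceq> \<Delta> ^ n" and t: "t \<preceq> \<Delta>" shows "u * t \<preceq> \<Delta> ^ Suc n"
proof -
  obtain v where v: "\<Delta> ^ n = u * v" using u by (rule left_dvdE)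
  have "t \<preceq> v * \<Delta>" using t Delta_power_left_dvd_mult[of 1 v] by (auto intro: left_dvd_trans)
  moreover have "\<Delta> ^ Suc n = u * (v * \<Delta>)" using v by (simp add: mult.assoc[symmetric] power_Suc2 del: power_Suc)
  ultimately show ?thesis by simp
qed

section \<open>Normal forms\<close>

text \<open>
  One step of the penetration process: the head of \<open>s w\<close> absorbs exactly the part of \<open>w\<close> that fits
  into the complement of \<open>s\<close>.
\<close>

lemma left_gcd_Delta_mult:
  assumes "s \<in> simples \<Delta>"
  shows "(s * w) \<^bold>\<and> \<Delta> = s * (compl \<Delta> s \<^bold>\<and> (w::'a))"
  using left_gcd_mult_left[of s w "compl \<Delta> s"] assms
  by (simp add: mult_compl left_gcd_commute[of w])

lemma left_gcd_simple_head:
  assumes "s \<in> simples \<Delta>"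
  shows "s \<^bold>\<and> (w::'a) = s \<^bold>\<and> (w \<^bold>\<and> \<Delta>)"
  using assms
  by (intro left_gcd_eqI) (auto simp: left_dvd_gcd_iff simples_def
      intro: left_dvd_trans left_dvd_trans[OF gcd_left_dvd(2)])

lemma greedy_head:
  "greedy \<Delta> xs \<Longrightarrow> prod_list xs \<^bold>\<and> \<Delta> = (if xs = [] then 1 else hd xs)"
proof (induction xs)
  case (Cons s xs)
  then show ?case
    using left_gcd_simple_head[OF compl_simple, of s "prod_list xs"]
    by (cases "xs = []") (auto simp: greedy_Cons left_gcd_Delta_mult simples_def intro: left_gcd_absorb)
qed auto

lemma greedy_compl_tail:
  assumes "greedy \<Delta> (s # xs)" shows "compl \<Delta> s \<^bold>\<and> prod_list xs = 1"
  using assms left_gcd_simple_head[OF compl_simple, of s "prod_list xs"] greedy_head[of xs]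
  by (auto simp: greedy_Cons split: if_splits)

text \<open>
  Splitting off the first letter \<open>s\<close> replaces \<open>\<Delta> ^ Suc i\<close> by \<open>\<partial>s \<Delta> ^ i\<close>. Since \<open>\<partial>s\<close> has no common
  divisor with the remaining word, it cannot contribute to the gcd, by
  \<open>left_dvd_Delta_power_of_coprime\<close>.
\<close>

lemma greedy_gcd_Delta_power:
  "greedy \<Delta> xs \<Longrightarrow> prod_list xs \<^bold>\<and> \<Delta> ^ i = prod_list (take i xs)"
proof (induction i arbitrary: xs)
  case (Suc i)
  show ?case
  proof (cases xs)
    case (Cons s ys)
    define c w where "c = compl \<Delta> s" and "w = prod_list ys"
    have s: "s \<in> simples \<Delta>" "greedy \<Delta> ys" using Suc.prems Cons by (auto simp: greedy_Cons)
    have cw: "c \<^bold>\<and> w = 1"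
      using greedy_compl_tail Suc.prems Cons by (simp add: c_def w_def)
    have "w \<^bold>\<and> (c * \<Delta> ^ i) = w \<^bold>\<and> \<Delta> ^ i"
    proof (rule left_gcd_eqI)
      show "w \<^bold>\<and> \<Delta> ^ i \<preceq> c * \<Delta> ^ i"
        using Delta_power_left_dvd_mult gcd_left_dvd(2) left_dvd_trans by blast
      fix e assume e: "e \<preceq> w" "e \<preceq> c * \<Delta> ^ i"
      have "c \<^bold>\<and> e \<preceq> c \<^bold>\<and> w" using e left_dvd_trans[OF gcd_left_dvd(2)] by (auto simp: left_dvd_gcd_iff)
      then have "c \<^bold>\<and> e = 1" using cw by simp
      then show "e \<preceq> w \<^bold>\<and> \<Delta> ^ i"
        using e left_dvd_Delta_power_of_coprime by (auto simp: left_dvd_gcd_iff)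
    qed auto
    moreover have "s * w \<^bold>\<and> \<Delta> ^ Suc i = s * (w \<^bold>\<and> (c * \<Delta> ^ i))"
      using s by (simp add: left_gcd_mult_left[symmetric] mult.assoc[symmetric] c_def mult_compl)
    ultimately show ?thesis using Suc.IH s Cons by (simp add: w_def)
  qed auto
qed auto

lemma greedy_unique:
  "greedy \<Delta> xs \<Longrightarrow> greedy \<Delta> ys \<Longrightarrow> prod_list xs = prod_list ys \<Longrightarrow> xs = ys"
proof (induction xs arbitrary: ys)
  case Nil
  then show ?case using greedy_head[of ys] by (cases ys) (auto simp: greedy_Cons)
next
  case (Cons s xs)
  have ys: "ys \<noteq> []" using Cons.prems greedy_head[of "s # xs"] by (auto simp: greedy_Cons)
  then have "hd ys = s" using greedy_head[of ys] greedy_head[of "s # xs"] Cons.prems by simp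
  then obtain zs where zs: "ys = s # zs" using ys by (cases ys) auto
  then have "prod_list xs = prod_list zs" using Cons.prems left_cancel by auto
  then show ?case using Cons zs by (auto simp: greedy_Cons)
qed

lemma wf_right_divisor: "wf {(q, m). m \<succeq> q \<and> q \<noteq> (m::'a)}"
  using right_no_chain by (auto simp: wf_iff_no_infinite_down_chain)

lemma wf_left_divisor: "wf {(q, m). q \<preceq> m \<and> q \<noteq> (m::'a)}"
  using left_no_chain by (auto simp: wf_iff_no_infinite_down_chain)

lemma right_divisor_induct [case_names less]:
  assumes "\<And>x. (\<And>h y. x = h * y \<Longrightarrow> h \<noteq> 1 \<Longrightarrow> P y) \<Longrightarrow> P x"
  shows "P (x::'a)"
proof (induction x rule: wf_induct_rule[OF wf_right_divisor])
  case (1 x)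
  show ?case
  proof (rule assms)
    fix h y assume x: "x = h * y" "h \<noteq> 1"
    then have "y \<noteq> x" using right_cancel[of h y 1] by auto
    then show "P y" using 1 x by (auto simp: right_mult_def)
  qed
qed

text \<open>
  Split off the head repeatedly. The process stops because the remainders form a chain of proper right
  divisors.
\<close>

lemma ex_greedy: "\<exists>xs. greedy \<Delta> xs \<and> prod_list xs = (x::'a)"
proof (induction x rule: right_divisor_induct)
  case (less x)
  show ?case
  proof (cases "x = 1")
    case True
    then show ?thesis by (intro exI[of _ "[]"]) auto
  next
    case False
    define h where "h = x \<^bold>\<and> \<Delta>"
    have h: "h \<in> simples \<Delta>" by (simp add: h_def simples_def)
    obtain y where y: "x = h * y" using gcd_left_dvd(1)[of x \<Delta>] unfolding h_def by (rule left_dvdE)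
    have "\<exists>s \<in> simples \<Delta>. s \<noteq> 1 \<and> s \<preceq> x"
      using False
    proof (induction x rule: simples_induct)
      case (mult s x)
      then show ?case by (cases "s = 1") auto
    qed auto
    then have "h \<noteq> 1" unfolding h_def simples_def by (metis left_dvd_gcd_iff left_dvd_one_iff mem_Collect_eq)
    then obtain xs where xs: "greedy \<Delta> xs" "prod_list xs = y" using less y by blast
    have "h * (compl \<Delta> h \<^bold>\<and> y) = h * 1"
      using left_gcd_Delta_mult[OF h, of y] by (metis h_def mult_1_right y)
    then have "compl \<Delta> h \<^bold>\<and> y = 1" by (rule left_cancel)
    then have "compl \<Delta> h \<^bold>\<and> hd xs = 1" if "xs \<noteq> []"
    proof -
      have "y \<^bold>\<and> \<Delta> = hd xs" using greedy_head[OF xs(1)] xs(2) that by simp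
      then show ?thesis
        using left_gcd_simple_head[OF compl_simple[OF h], of y] \<open>compl \<Delta> h \<^bold>\<and> y = 1\<close> by metis
    qed
    then have "greedy \<Delta> (h # xs)" using h \<open>h \<noteq> 1\<close> xs by (simp add: greedy_Cons)
    then show ?thesis using y xs by (intro exI[of _ "h # xs"]) simp
  qed
qed

lemma normal_form_eqI: "greedy \<Delta> xs \<Longrightarrow> normal_form \<Delta> (prod_list xs) = xs"
  unfolding normal_form_def is_left_normal_form_iff_greedy
  by (rule the_equality) (auto intro: greedy_unique)

text \<open>
  A letter \<open>\<Delta>\<close> can only follow a letter whose complement is trivial, that is another \<open>\<Delta>\<close>.
\<close>

lemma greedy_decompose:
  "greedy \<Delta> xs \<Longrightarrow> \<exists>r ys. xs = replicate r \<Delta> @ ys \<and> set ys \<subseteq> proper_simples \<Delta>"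
proof (induction xs)
  case Nil
  then show ?case by auto
next
  case (Cons s xs)
  then obtain r ys where ys: "xs = replicate r \<Delta> @ ys" "set ys \<subseteq> proper_simples \<Delta>"
    by (auto simp: greedy_Cons)
  show ?case
  proof (cases "s = \<Delta>")
    case True
    then show ?thesis using ys by (intro exI[of _ "Suc r"] exI[of _ ys]) simp
  next
    case False
    have s: "s \<in> simples \<Delta>" "s \<noteq> 1" using Cons.prems by (auto simp: greedy_Cons)
    have "r = 0"
    proof (rule ccontr)
      assume "r \<noteq> 0"
      then have "hd xs = \<Delta>" "xs \<noteq> []" using ys by (cases r; simp)+
      then have "compl \<Delta> s \<^bold>\<and> \<Delta> = 1" using Cons.prems by (auto simp: greedy_Cons)
      moreover have "compl \<Delta> s \<preceq> \<Delta>" using compl_simple s by (auto simp: simples_def)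
      ultimately have "compl \<Delta> s = 1" using left_gcd_absorb by metis
      then show False using mult_compl[OF s(1)] False by simp
    qed
    then show ?thesis using ys s False
      by (intro exI[of _ 0] exI[of _ "s # ys"]) (auto simp: proper_simples_def)
  qed
qed

lemma replicate_append_unique:
  assumes "replicate r d @ ys = replicate r' d @ ys'" "d \<notin> set ys" "d \<notin> set ys'"
  shows "r = r' \<and> ys = ys'"
proof -
  have "takeWhile (\<lambda>x. x = d) (replicate r d @ ys) = replicate r d" if "d \<notin> set ys" for r ys
    using that by (induction r) (auto simp: takeWhile_eq_Nil_iff)
  then show ?thesis using assms by (metis append_same_eq length_replicate same_append_eq)
qed

lemma
  assumes g: "greedy \<Delta> (replicate r \<Delta> @ ys)" and ys: "set ys \<subseteq> proper_simples \<Delta>"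
    and x: "x = \<Delta> ^ r * prod_list ys"
  shows infimum_eqI: "infimum \<Delta> x = r"
    and canonical_length_eqI: "canonical_length \<Delta> x = length ys"
proof -
  have pr: "prod_list (replicate r \<Delta>) = \<Delta> ^ r" by (induction r) auto
  have nf: "normal_form \<Delta> x = replicate r \<Delta> @ ys"
    using normal_form_eqI[OF g] x pr by simp
  have uniq: "r' = r \<and> ys' = ys"
    if "set ys' \<subseteq> proper_simples \<Delta>" "replicate r \<Delta> @ ys = replicate r' \<Delta> @ ys'" for r' ys'
    using replicate_append_unique[OF that(2)] that(1) ys by (auto simp: proper_simples_def)
  show "infimum \<Delta> x = r"
    unfolding infimum_def nf by (rule the_equality) (use ys uniq in blast)+
  show "canonical_length \<Delta> x = length ys"
    unfolding canonical_length_def nf by (rule the_equality) (use ys uniq in blast)+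
qed

text \<open>
  The elements of a layer are handled through their normal forms, which are the walks in the
  normal form graph.
\<close>

definition normal_words :: "nat \<Rightarrow> 'a list set"
  where "normal_words k = walks (proper_simples \<Delta>) (\<lambda>s t. compl \<Delta> s \<^bold>\<and> t = 1) k"

lemma normal_words_greedy: "w \<in> normal_words k \<Longrightarrow> greedy \<Delta> w"
  by (auto simp: normal_words_def walks_def greedy_def proper_simples_def)

lemma normal_words_length: "w \<in> normal_words k \<Longrightarrow> length w = k"
  by (auto simp: normal_words_def walks_def)

lemma finite_proper_simples: "finite (proper_simples \<Delta>)"
  using finite_simples by (simp add: proper_simples_def)

lemma finite_normal_words: "finite (normal_words k)"
  unfolding normal_words_def by (rule finite_walks[OF finite_proper_simples])

lemma bij_betw_normal_words: "bij_betw prod_list (normal_words k) (layer \<Delta> k)"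
proof (rule bij_betw_imageI)
  show "inj_on prod_list (normal_words k)"
    using greedy_unique normal_words_greedy by (blast intro: inj_onI)
  show "prod_list ` normal_words k = layer \<Delta> k"
  proof (intro equalityI subsetI)
    fix x assume "x \<in> prod_list ` normal_words k"
    then obtain w where w: "w \<in> normal_words k" "x = prod_list w" by blast
    have "greedy \<Delta> (replicate 0 \<Delta> @ w)" "set w \<subseteq> proper_simples \<Delta>" "x = \<Delta> ^ 0 * prod_list w"
      using w normal_words_greedy by (auto simp: normal_words_def walks_def)
    from infimum_eqI[OF this] canonical_length_eqI[OF this] show "x \<in> layer \<Delta> k"
      using w normal_words_length by (simp add: layer_def)
  next
    fix x assume x: "x \<in> layer \<Delta> k"
    obtain xs where xs: "greedy \<Delta> xs" "prod_list xs = x" using ex_greedy by blast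
    obtain r ys where ys: "xs = replicate r \<Delta> @ ys" "set ys \<subseteq> proper_simples \<Delta>"
      using greedy_decompose xs by blast
    have "prod_list (replicate r \<Delta>) = \<Delta> ^ r" by (induction r) auto
    then have *: "greedy \<Delta> (replicate r \<Delta> @ ys)" "set ys \<subseteq> proper_simples \<Delta>" "x = \<Delta> ^ r * prod_list ys"
      using xs ys by auto
    from infimum_eqI[OF *] canonical_length_eqI[OF *] x have "r = 0" "length ys = k"
      by (auto simp: layer_def)
    then have "ys \<in> normal_words k" "prod_list ys = x"
      using xs ys by (auto simp: normal_words_def walks_def greedy_def)
    then show "x \<in> prod_list ` normal_words k" by blast
  qed
qed

lemma normal_words_layer:
  assumes "w \<in> normal_words k"
  shows "infimum \<Delta> (prod_list w) = 0" "canonical_length \<Delta> (prod_list w) = k"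
  using assms bij_betwE[OF bij_betw_normal_words] by (auto simp: layer_def)

lemma strip_infimum_eq: "strip_infimum \<Delta> x * \<Delta> ^ infimum \<Delta> x = (x::'a)"
proof -
  obtain xs where xs: "greedy \<Delta> xs" "prod_list xs = x" using ex_greedy by blast
  obtain r ys where ys: "xs = replicate r \<Delta> @ ys" "set ys \<subseteq> proper_simples \<Delta>"
    using greedy_decompose xs by blast
  have "prod_list (replicate r \<Delta>) = \<Delta> ^ r" by (induction r) auto
  then have *: "greedy \<Delta> (replicate r \<Delta> @ ys)" "set ys \<subseteq> proper_simples \<Delta>" "x = \<Delta> ^ r * prod_list ys"
    using xs ys by auto
  obtain z where "z * \<Delta> ^ r = x" using Delta_power_quasi_central_left[of r "prod_list ys"] * by metis
  then show ?thesis unfolding strip_infimum_def infimum_eqI[OF *]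
    by (rule theI) (use \<open>z * \<Delta> ^ r = x\<close> right_cancel in metis)
qed

lemma greedy_take: "greedy \<Delta> xs \<Longrightarrow> greedy \<Delta> (take n xs)"
  and greedy_drop: "greedy \<Delta> xs \<Longrightarrow> greedy \<Delta> (drop n xs)"
  by (auto simp: greedy_def successively_takeI successively_dropI dest: in_set_takeD in_set_dropD)

text \<open>
  Since \<open>x \<^bold>\<and> \<Delta> ^ i\<close> consists of the first \<open>i\<close> letters, the powers of \<open>\<Delta>\<close> that \<open>x\<close> divides detect the
  number of letters.
\<close>

lemma greedy_left_dvd_Delta_power_iff:
  assumes "greedy \<Delta> xs" shows "prod_list xs \<preceq> \<Delta> ^ i \<longleftrightarrow> length xs \<le> i"
proof
  assume "prod_list xs \<preceq> \<Delta> ^ i"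
  then have "prod_list (take i xs) = prod_list xs"
    using greedy_gcd_Delta_power[OF assms] left_gcd_absorb by metis
  then have "take i xs = xs" using greedy_unique greedy_take assms by blast
  then show "length xs \<le> i" by (metis length_take min.cobounded2)
next
  assume "length xs \<le> i"
  then show "prod_list xs \<preceq> \<Delta> ^ i"
    using greedy_gcd_Delta_power[OF assms, of i] gcd_left_dvd(2) by (metis take_all)
qed

text \<open>
  Divisibility from below keeps the number of letters at least \<open>k\<close>, divisibility of \<open>\<Delta> ^ k\<close> keeps it
  at most \<open>k\<close>, and the absence of \<open>\<Delta>\<close> keeps all letters proper. So for a
  penetration sequence of \<open>x\<close> with initial \<open>m\<close> such that \<open>\<Delta>\<close> does not divide \<open>x m\<close>, the elements between
  \<open>x\<close> and \<open>x m\<close> stay in the layer of \<open>x\<close>.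
\<close>

lemma ex_normal_word_between:
  assumes xs: "xs \<in> normal_words k"
    and y: "prod_list xs \<preceq> y" "y \<preceq> \<Delta> ^ k" "\<not> \<Delta> \<preceq> y"
  shows "\<exists>ys \<in> normal_words k. prod_list ys = y"
proof -
  obtain zs where zs: "greedy \<Delta> zs" "prod_list zs = y" using ex_greedy by blast
  obtain r ys where ys: "zs = replicate r \<Delta> @ ys" "set ys \<subseteq> proper_simples \<Delta>"
    using greedy_decompose zs by blast
  have "r = 0"
  proof (rule ccontr)
    assume "r \<noteq> 0"
    then have "zs = \<Delta> # replicate (r - 1) \<Delta> @ ys" using ys by (cases r) auto
    then show False using zs y by auto
  qed
  then have eq: "zs = ys" using ys by simp
  have "length ys \<le> k" using greedy_left_dvd_Delta_power_iff zs y eq by metis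
  moreover have "prod_list xs \<preceq> \<Delta> ^ length ys"
    using greedy_left_dvd_Delta_power_iff[of ys "length ys"] zs y eq left_dvd_trans by blast
  then have "k \<le> length ys"
    using greedy_left_dvd_Delta_power_iff[OF normal_words_greedy[OF xs]] normal_words_length[OF xs] by simp
  ultimately show ?thesis using zs ys eq by (auto simp: normal_words_def walks_def greedy_def)
qed

section \<open>Atoms\<close>

lemma ex_atom_left_dvd:
  assumes "m \<noteq> (1::'a)" shows "\<exists>a \<in> monoid_atoms. a \<preceq> m"
  using assms
proof (induction m rule: wf_induct_rule[OF wf_left_divisor])
  case (1 m)
  show ?case
  proof (cases "m \<in> monoid_atoms")
    case True
    then show ?thesis using left_dvd_refl by blast
  next
    case False
    then obtain p q where pq: "m = p * q" "p \<noteq> 1" "q \<noteq> 1" using 1 by (auto simp: monoid_atoms_def)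
    then have "p \<noteq> m" using left_cancel[of p q 1] by auto
    then obtain a where "a \<in> monoid_atoms" "a \<preceq> p" using "1.IH"[of p] pq by auto
    then show ?thesis using pq left_dvd_mult_right by blast
  qed
qed

text \<open>
  Multiply \<open>x\<close> by the atoms of a factorization of \<open>m\<close> one at a time and stop at the first one that changes
  the value of \<open>H\<close>. Splitting off atoms on the left terminates because the remainders are proper
  right divisors.
\<close>

lemma ex_atom_step:
  assumes "H x \<noteq> H (x * (m::'a))"
  shows "\<exists>b a c. m = b * a * c \<and> a \<in> monoid_atoms \<and> H (x * b) \<noteq> H (x * b * a)"
  using assms
proof (induction m arbitrary: x rule: right_divisor_induct)
  case (less m)
  then have "m \<noteq> 1" by auto
  then obtain a where a: "a \<in> monoid_atoms" "a \<preceq> m" using ex_atom_left_dvd by blast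
  obtain n where n: "m = a * n" using a(2) by (rule left_dvdE)
  show ?case
  proof (cases "H x = H (x * a)")
    case False
    then show ?thesis using a n by (intro exI[of _ 1] exI[of _ a] exI[of _ n]) auto
  next
    case True
    have "a \<noteq> 1" using a by (auto simp: monoid_atoms_def)
    moreover have "H (x * a) \<noteq> H (x * a * n)" using True less.prems n by (simp add: mult.assoc)
    ultimately obtain b a' c where "n = b * a' * c" "a' \<in> monoid_atoms" "H (x * a * b) \<noteq> H (x * a * b * a')"
      using less.IH[OF n] by blast
    then show ?thesis
      using n by (intro exI[of _ "a * b"] exI[of _ a'] exI[of _ c]) (simp add: mult.assoc)
  qed
qed

lemma atoms_subset_simples: "(monoid_atoms :: 'a set) \<subseteq> simples \<Delta>"
proof
  fix a :: 'a assume "a \<in> monoid_atoms"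
  then show "a \<in> simples \<Delta>"
  proof (induction a rule: simples_induct)
    case (mult s x)
    then have "s = 1 \<or> x = 1" by (auto simp: monoid_atoms_def)
    then show ?case using mult by auto
  qed simp
qed

lemma finite_atoms: "finite (monoid_atoms :: 'a set)"
  by (rule finite_subset[OF atoms_subset_simples finite_simples])

section \<open>Penetration forced by a change of the head\<close>

text \<open>
  The last condition excludes the case that \<open>a\<close> completes a factor \<open>\<Delta>\<close>, which would shift the whole
  normal form when the infimum is stripped.
\<close>

definition deep_pairs :: "nat \<Rightarrow> ('a list \<times> 'a) set"
  where "deep_pairs j = {(w, a) \<in> normal_words j \<times> monoid_atoms.
    prod_list w \<^bold>\<and> \<Delta> \<noteq> (prod_list w * a) \<^bold>\<and> \<Delta> \<and> \<not> \<Delta> \<preceq> prod_list w * a}"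

lemma finite_deep_pairs: "finite (deep_pairs j)"
  by (rule finite_subset[of _ "normal_words j \<times> monoid_atoms"])
     (auto simp: deep_pairs_def finite_normal_words finite_atoms)

text \<open>
  Let \<open>x = u y\<close>, where \<open>y\<close> consists of the last \<open>j\<close> letters. If \<open>x\<close> and the stripped product \<open>z\<close> agreed
  up to the first letter of \<open>y\<close>, then \<open>u (H y)\<close> would be \<open>z \<^bold>\<and> \<Delta> ^ (k - j + 1)\<close>. If nothing was
  stripped, that gcd is also a multiple of \<open>u (H (y a))\<close>, which forces \<open>H (y a) = H y\<close>. If a power of \<open>\<Delta>\<close>
  was stripped, cancelling \<open>u\<close> shows that \<open>y a\<close> is a multiple of \<open>\<Delta>\<close>.
\<close>

lemma pd_ge_of_deep:
  assumes w: "w \<in> normal_words k" and j: "1 \<le> j" "j \<le> k"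
    and deep: "(drop (k - j) w, a) \<in> deep_pairs j"
  shows "j \<le> pd \<Delta> (prod_list w) a"
proof -
  define x u y z r where "x = prod_list w" and "u = prod_list (take (k - j) w)"
    and "y = prod_list (drop (k - j) w)"
    and "z = strip_infimum \<Delta> (x * a)" and "r = infimum \<Delta> (x * a)"
  have len: "length w = k" and g: "greedy \<Delta> w"
    using w normal_words_length normal_words_greedy by auto
  have xuy: "x = u * y" unfolding x_def u_def y_def by (metis append_take_drop_id prod_list.append)
  have z: "z * \<Delta> ^ r = x * a" unfolding z_def r_def by (rule strip_infimum_eq)
  have strip: "strip_infimum \<Delta> x = x"
    using strip_infimum_eq[of x] normal_words_layer[OF w] by (simp add: x_def)
  have cl: "canonical_length \<Delta> x = k" using normal_words_layer[OF w] by (simp add: x_def)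
  have y\<Delta>: "y \<^bold>\<and> \<Delta> \<noteq> (y * a) \<^bold>\<and> \<Delta>" "\<not> \<Delta> \<preceq> y * a"
    using deep by (auto simp: deep_pairs_def y_def)
  have differ: "x \<^bold>\<and> \<Delta> ^ Suc (k - j) \<noteq> z \<^bold>\<and> \<Delta> ^ Suc (k - j)"
  proof
    assume eq: "x \<^bold>\<and> \<Delta> ^ Suc (k - j) = z \<^bold>\<and> \<Delta> ^ Suc (k - j)"
    have "k - j < length w" using j len by simp
    then have "x \<^bold>\<and> \<Delta> ^ Suc (k - j) = u * w ! (k - j)"
      unfolding x_def u_def greedy_gcd_Delta_power[OF g] by (simp add: take_Suc_conv_app_nth)
    also have "w ! (k - j) = y \<^bold>\<and> \<Delta>"
      using greedy_head[OF greedy_drop[OF g], of "k - j"] \<open>k - j < length w\<close>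
      by (simp add: y_def hd_drop_conv_nth)
    finally have head: "z \<^bold>\<and> \<Delta> ^ Suc (k - j) = u * (y \<^bold>\<and> \<Delta>)" using eq by simp
    then have uz: "u * (y \<^bold>\<and> \<Delta>) \<preceq> z" using gcd_left_dvd(1) by metis
    show False
    proof (cases r)
      case 0
      have "u \<preceq> \<Delta> ^ (k - j)"
        unfolding u_def using greedy_left_dvd_Delta_power_iff[OF greedy_take[OF g]] by simp
      then have "u * ((y * a) \<^bold>\<and> \<Delta>) \<preceq> \<Delta> ^ Suc (k - j)"
        by (rule mult_simple_left_dvd_Delta_power) simp
      moreover have "z = u * (y * a)" using z 0 xuy by (simp add: mult.assoc)
      ultimately have "u * ((y * a) \<^bold>\<and> \<Delta>) \<preceq> u * (y \<^bold>\<and> \<Delta>)"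
        unfolding head[symmetric] by (simp add: left_dvd_gcd_iff)
      then have "(y * a) \<^bold>\<and> \<Delta> \<preceq> y \<^bold>\<and> \<Delta>" by simp
      moreover have "y \<^bold>\<and> \<Delta> \<preceq> (y * a) \<^bold>\<and> \<Delta>"
        by (simp add: left_dvd_gcd_iff left_dvd_mult_right)
      ultimately show False using y\<Delta> left_dvd_antisym by blast
    next
      case (Suc r')
      obtain c where c: "z = u * (y \<^bold>\<and> \<Delta>) * c" using uz by (rule left_dvdE)
      have "u * (y * a) = u * ((y \<^bold>\<and> \<Delta>) * c * \<Delta> ^ r)" using z c xuy by (simp add: mult.assoc)
      then have "y * a = (y \<^bold>\<and> \<Delta>) * c * \<Delta> ^ r" by (rule left_cancel)
      moreover have "\<Delta> \<preceq> (y \<^bold>\<and> \<Delta>) * c * \<Delta> ^ r"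
        by (rule Delta_left_dvd_mult_left) (simp add: Suc)
      ultimately show False using y\<Delta> by simp
    qed
  qed
  define S where "S = {i \<in> {0..k}. x \<^bold>\<and> \<Delta> ^ i = z \<^bold>\<and> \<Delta> ^ i}"
  have "i \<le> k - j" if i: "i \<in> S" for i
  proof (rule ccontr)
    assume "\<not> i \<le> k - j"
    then have "\<Delta> ^ Suc (k - j) \<preceq> \<Delta> ^ i" by (intro Delta_power_mono) simp
    then have "v \<^bold>\<and> \<Delta> ^ Suc (k - j) = (v \<^bold>\<and> \<Delta> ^ i) \<^bold>\<and> \<Delta> ^ Suc (k - j)" for v
      by (intro left_gcd_eqI) (auto simp: left_dvd_gcd_iff simp del: power_Suc
          intro: left_dvd_trans left_dvd_trans[OF gcd_left_dvd(1)] left_dvd_trans[OF gcd_left_dvd(2)])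
    then show False using differ i unfolding S_def by (metis (mono_tags, lifting) mem_Collect_eq)
  qed
  moreover have "finite S" "0 \<in> S" by (auto simp: S_def)
  ultimately have "Max S \<le> k - j" by (subst Max_le_iff) auto
  moreover have "pd \<Delta> x a = k - Max S"
    by (simp add: pd_def strip cl S_def z_def)
  ultimately show ?thesis using j by (simp add: x_def)
qed

section \<open>Penetration sequences\<close>

text \<open>
  Requiring \<open>m \<preceq> \<partial>s\<close> for all letters and not only for the last one does not change the set of
  penetration sequences: the remaining letters satisfy it by their recursion. In this form
  penetration sequences are the walks of a graph, hence closed under factors.
\<close>

definition penetration_letters :: "('a \<times> 'a) set"
  where "penetration_letters =
    {(s, m) \<in> proper_simples \<Delta> \<times> proper_simples \<Delta>. m \<preceq> compl \<Delta> s}"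

definition penetration_edge :: "'a \<times> 'a \<Rightarrow> 'a \<times> 'a \<Rightarrow> bool"
  where "penetration_edge = (\<lambda>(t, n) (s, m).
    s * m \<noteq> \<Delta> \<and> compl \<Delta> t \<^bold>\<and> s = 1 \<and> n = compl \<Delta> t \<^bold>\<and> (s * m))"

lemma penetration_seqs_eq_walks:
  "penetration_seqs \<Delta> k = walks penetration_letters penetration_edge k"
proof (intro equalityI subsetI)
  fix w assume w: "w \<in> penetration_seqs \<Delta> k"
  then have len: "length w = k" and sub: "set w \<subseteq> proper_simples \<Delta> \<times> proper_simples \<Delta>"
    and last: "1 \<le> k \<Longrightarrow> snd (w ! (k - 1)) \<preceq> compl \<Delta> (fst (w ! (k - 1)))"
    and step: "\<And>i. 1 \<le> i \<Longrightarrow> i < k \<Longrightarrow> penetration_edge (w ! (k - (i + 1))) (w ! (k - i))"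
    by (auto simp: penetration_seqs_def penetration_edge_def Let_def case_prod_beta)
  have edge: "penetration_edge (w ! i) (w ! Suc i)" if "Suc i < k" for i
    using step[of "k - Suc i"] that by (simp add: Suc_diff_Suc)
  have "snd (w ! i) \<preceq> compl \<Delta> (fst (w ! i))" if "i < k" for i
  proof (cases "Suc i < k")
    case True
    then show ?thesis using edge[OF True] by (auto simp: penetration_edge_def case_prod_beta)
  next
    case False
    then have "i = k - 1" using that by simp
    then show ?thesis using last that by simp
  qed
  then have "set w \<subseteq> penetration_letters"
    using sub len by (fastforce simp: penetration_letters_def in_set_conv_nth)
  then show "w \<in> walks penetration_letters penetration_edge k"
    using len edge by (auto simp: walks_def successively_conv_nth)
next
  fix w assume w: "w \<in> walks penetration_letters penetration_edge k"
  then have len: "length w = k" and sub: "set w \<subseteq> penetration_letters"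
    and step: "\<And>i. Suc i < k \<Longrightarrow> penetration_edge (w ! i) (w ! Suc i)"
    by (auto simp: walks_def successively_conv_nth)
  have "penetration_edge (w ! (k - Suc i)) (w ! (k - i))" if "1 \<le> i" "i < k" for i
    using step[of "k - Suc i"] that by (simp add: Suc_diff_Suc)
  moreover have "w ! (k - 1) \<in> penetration_letters" if "1 \<le> k"
    using sub len that nth_mem[of "k - 1" w] by auto
  moreover have "set w \<subseteq> proper_simples \<Delta> \<times> proper_simples \<Delta>"
    using sub by (auto simp: penetration_letters_def)
  ultimately show "w \<in> penetration_seqs \<Delta> k"
    using len
    by (auto simp: penetration_seqs_def penetration_edge_def penetration_letters_def Let_def case_prod_beta)
qed

lemma finite_penetration_letters: "finite penetration_letters"
  by (rule finite_subset[of _ "proper_simples \<Delta> \<times> proper_simples \<Delta>"])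
     (auto simp: penetration_letters_def finite_proper_simples)

lemma finite_penetration_seqs: "finite (penetration_seqs \<Delta> k)"
  unfolding penetration_seqs_eq_walks by (rule finite_walks[OF finite_penetration_letters])

lemma penetration_seq_normal_word:
  assumes "w \<in> penetration_seqs \<Delta> k" shows "map fst w \<in> normal_words k"
proof -
  have "successively (\<lambda>p q. compl \<Delta> (fst p) \<^bold>\<and> fst q = 1) w"
    using assms
    by (auto simp: penetration_seqs_eq_walks walks_def penetration_edge_def case_prod_beta
        elim: successively_mono)
  then show ?thesis
    using assms
    by (auto simp: penetration_seqs_eq_walks walks_def normal_words_def penetration_letters_def successively_map)
qed

lemma penetration_seq_Cons:
  "p # w \<in> penetration_seqs \<Delta> (Suc k) \<longleftrightarrow>
    p \<in> penetration_letters \<and> w \<in> penetration_seqs \<Delta> k \<and> (w \<noteq> [] \<longrightarrow> penetration_edge p (hd w))"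
  by (auto simp: penetration_seqs_eq_walks walks_def successively_Cons)

text \<open>
  Reading a penetration sequence from right to left computes the head of the product: at each letter
  the head \<open>s m\<close> of what lies to the right passes its common part with the complement on to the left.
\<close>

lemma
  assumes "w \<in> penetration_seqs \<Delta> k" "w \<noteq> []"
  shows penetration_seq_head:
      "(prod_list (map fst w) * snd (last w)) \<^bold>\<and> \<Delta> = fst (hd w) * snd (hd w)" (is ?head)
    and penetration_seq_left_dvd:
      "prod_list (map fst w) * snd (last w) \<preceq> \<Delta> ^ k" (is ?dvd)
proof -
  have "?head \<and> ?dvd"
    using assms
  proof (induction w arbitrary: k)
    case (Cons p w)
    obtain t n where p: "p = (t, n)" by (cases p)
    obtain l where k: "k = Suc l" using Cons.prems by (auto simp: penetration_seqs_def)
    have pw: "p \<in> penetration_letters" "w \<in> penetration_seqs \<Delta> l"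
      "w \<noteq> [] \<Longrightarrow> penetration_edge p (hd w)"
      using Cons.prems unfolding k penetration_seq_Cons by auto
    have t: "t \<in> simples \<Delta>" "n \<preceq> compl \<Delta> t"
      using pw p by (auto simp: penetration_letters_def proper_simples_def)
    show ?case
    proof (cases "w = []")
      case True
      have "t * n \<preceq> t * compl \<Delta> t" using t(2) by simp
      then have tn: "t * n \<preceq> \<Delta>" using mult_compl[OF t(1)] by simp
      moreover have "\<Delta> \<preceq> \<Delta> ^ k" using k by simp
      ultimately show ?thesis
        using True p left_gcd_absorb left_dvd_trans by auto
    next
      case False
      define v where "v = prod_list (map fst w) * snd (last w)"
      have IH: "v \<^bold>\<and> \<Delta> = fst (hd w) * snd (hd w)" "v \<preceq> \<Delta> ^ l"
        using Cons.IH[OF pw(2) False] by (auto simp: v_def)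
      have eq: "prod_list (map fst (p # w)) * snd (last (p # w)) = t * v"
        using False p by (simp add: v_def mult.assoc)
      have "(t * v) \<^bold>\<and> \<Delta> = t * (compl \<Delta> t \<^bold>\<and> (v \<^bold>\<and> \<Delta>))"
        using left_gcd_Delta_mult[OF t(1)] left_gcd_simple_head[OF compl_simple[OF t(1)], of v] by metis
      also have "\<dots> = t * n"
        using pw(3)[OF False] IH p by (auto simp: penetration_edge_def case_prod_beta)
      finally show ?thesis
        unfolding eq k using simple_mult_left_dvd_Delta_power[OF t(1) IH(2)] p by simp
    qed
  qed auto
  then show ?head ?dvd by auto
qed

text \<open>
  Every \<open>m\<close> is computed from its \<open>s\<close> and the letter to its right, so the normal form and the initial \<open>m\<close> suffice.
\<close>

lemma penetration_seq_determined:
  assumes "w \<in> penetration_seqs \<Delta> k" "w' \<in> penetration_seqs \<Delta> k"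
    "map fst w = map fst w'" "snd (last w) = snd (last w')"
  shows "w = w'"
  using assms
proof (induction w arbitrary: w' k)
  case Nil
  then show ?case by simp
next
  case (Cons p w)
  obtain q v where w': "w' = q # v" using Cons.prems by (cases w') auto
  obtain l where k: "k = Suc l" using Cons.prems by (auto simp: penetration_seqs_def)
  have pw: "w \<in> penetration_seqs \<Delta> l" "v \<in> penetration_seqs \<Delta> l"
    "w \<noteq> [] \<Longrightarrow> penetration_edge p (hd w)" "v \<noteq> [] \<Longrightarrow> penetration_edge q (hd v)"
    using Cons.prems unfolding k penetration_seq_Cons w' by auto
  have fst: "fst p = fst q" "map fst w = map fst v" using Cons.prems w' by auto
  show ?case
  proof (cases "w = []")
    case True
    then show ?thesis using Cons.prems fst w' by (simp add: prod_eq_iff)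
  next
    case False
    then have "v \<noteq> []" using fst(2) by auto
    then have "w = v" using Cons.IH[OF pw(1,2) fst(2)] Cons.prems(4) False w' by simp
    then show ?thesis
      using pw(3,4) False fst(1) w' by (auto simp: penetration_edge_def case_prod_beta prod_eq_iff)
  qed
qed

text \<open>
  The head of \<open>x\<close> is the first \<open>s\<close>, the head of \<open>x m\<close> is the first \<open>s m\<close>, and these differ. Hence one of
  the atoms of \<open>m\<close>, say \<open>a\<close> in \<open>m = b a c\<close>, changes the head of \<open>x b\<close>. As the head of \<open>x m\<close> is not \<open>\<Delta>\<close>, no
  divisor of \<open>x m\<close> is a multiple of \<open>\<Delta>\<close>.
\<close>

lemma ex_deep_pair:
  assumes w: "w \<in> penetration_seqs \<Delta> j" "w \<noteq> []" and ne: "fst (hd w) * snd (hd w) \<noteq> \<Delta>"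
  shows "\<exists>ys a b. (ys, a) \<in> deep_pairs j \<and> b \<in> simples \<Delta> \<and> prod_list ys = prod_list (map fst w) * b"
proof -
  define x m where "x = prod_list (map fst w)" and "m = snd (last w)"
  have nw: "map fst w \<in> normal_words j" by (rule penetration_seq_normal_word[OF w(1)])
  have "hd w \<in> penetration_letters" "last w \<in> penetration_letters"
    using w by (auto simp: penetration_seqs_eq_walks walks_def)
  then have hd: "snd (hd w) \<noteq> 1" and m: "m \<in> simples \<Delta>"
    by (auto simp: penetration_letters_def proper_simples_def m_def)
  have "x \<^bold>\<and> \<Delta> = fst (hd w)"
    using greedy_head[OF normal_words_greedy[OF nw]] w(2) by (simp add: x_def hd_map)
  moreover have xm: "(x * m) \<^bold>\<and> \<Delta> = fst (hd w) * snd (hd w)"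
    using penetration_seq_head[OF w] by (simp add: x_def m_def)
  ultimately have "x \<^bold>\<and> \<Delta> \<noteq> (x * m) \<^bold>\<and> \<Delta>"
    using hd left_cancel[of "fst (hd w)" "snd (hd w)" 1] by auto
  then obtain b a c where bac: "m = b * a * c" "a \<in> monoid_atoms" "(x * b) \<^bold>\<and> \<Delta> \<noteq> (x * b * a) \<^bold>\<and> \<Delta>"
    using ex_atom_step[of "\<lambda>v. v \<^bold>\<and> \<Delta>" x m] by blast
  have no\<Delta>: "\<not> \<Delta> \<preceq> v" if "v \<preceq> x * m" for v
  proof
    assume "\<Delta> \<preceq> v"
    then have "\<Delta> \<preceq> x * m" using that left_dvd_trans by blast
    then have "(x * m) \<^bold>\<and> \<Delta> = \<Delta>" using left_gcd_absorb left_gcd_commute by metis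
    then show False using ne xm by simp
  qed
  have dvd: "x * b * a \<preceq> x * m" "x * b \<preceq> x * m" using bac(1) by (simp_all add: mult.assoc)
  have "b \<in> simples \<Delta>" using m bac(1) simple_left_dvd[of m b] by (simp add: mult.assoc)
  moreover obtain ys where ys: "ys \<in> normal_words j" "prod_list ys = x * b"
    using ex_normal_word_between[OF nw, of "x * b"] no\<Delta>[OF dvd(2)] x_def
      left_dvd_trans[OF dvd(2)] penetration_seq_left_dvd[OF w] m_def by auto
  moreover have "(ys, a) \<in> deep_pairs j"
    using ys bac no\<Delta>[OF dvd(1)] by (simp add: deep_pairs_def)
  ultimately show ?thesis unfolding x_def by blast
qed

text \<open>
  Sequences of length \<open>Suc j\<close> are used because only a letter that has a left neighbour is guaranteed
  to satisfy \<open>s m \<noteq> \<Delta>\<close>. The deep pair, the prefix \<open>b\<close> and the initial \<open>m\<close> determine the sequence: \<open>x\<close> is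
  recovered from \<open>x b\<close> by cancellation.
\<close>

lemma card_penetration_seqs_le_deep_pairs:
  assumes j: "j \<ge> 1"
  shows "card (penetration_seqs \<Delta> (Suc j)) \<le>
    (card penetration_letters * (card (simples \<Delta>))\<^sup>2) * card (deep_pairs j)"
proof -
  define G where "G = {w \<in> penetration_seqs \<Delta> j. fst (hd w) * snd (hd w) \<noteq> \<Delta>}"
  have finG: "finite G" using finite_penetration_seqs by (simp add: G_def)
  have ne: "w \<noteq> []" if "w \<in> G" for w using that j by (auto simp: G_def penetration_seqs_def)
  have "\<forall>w \<in> G. \<exists>ys a b. (ys, a) \<in> deep_pairs j \<and> b \<in> simples \<Delta> \<and>
      prod_list ys = prod_list (map fst w) * b"
    using ex_deep_pair ne by (auto simp: G_def)
  then obtain Y A B where YAB: "\<And>w. w \<in> G \<Longrightarrow> (Y w, A w) \<in> deep_pairs j \<and> B w \<in> simples \<Delta> \<and>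
      prod_list (Y w) = prod_list (map fst w) * B w"
    by metis
  have "card G \<le> card (deep_pairs j \<times> simples \<Delta> \<times> simples \<Delta>)"
  proof (rule card_inj_on_le)
    show "inj_on (\<lambda>w. ((Y w, A w), B w, snd (last w))) G"
    proof (rule inj_onI)
      fix w v assume w: "w \<in> G" and v: "v \<in> G"
        and eq: "((Y w, A w), B w, snd (last w)) = ((Y v, A v), B v, snd (last v))"
      have "prod_list (map fst w) * B w = prod_list (map fst v) * B w"
        using YAB[OF w] YAB[OF v] eq by auto
      then have "prod_list (map fst w) = prod_list (map fst v)" by (rule right_cancel)
      then have "map fst w = map fst v"
        using w v by (intro greedy_unique normal_words_greedy[OF penetration_seq_normal_word, of _ j]) (auto simp: G_def)
      then show "w = v" using penetration_seq_determined w v eq by (auto simp: G_def)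
    qed
    have "snd (last w) \<in> simples \<Delta>" if "w \<in> G" for w
    proof -
      have "last w \<in> penetration_letters"
        using that ne[OF that] by (auto simp: G_def penetration_seqs_eq_walks walks_def)
      then show ?thesis by (auto simp: penetration_letters_def proper_simples_def)
    qed
    then show "(\<lambda>w. ((Y w, A w), B w, snd (last w))) ` G \<subseteq> deep_pairs j \<times> simples \<Delta> \<times> simples \<Delta>"
      using YAB by auto
  qed (simp add: finite_deep_pairs finite_simples)
  then have G: "card G \<le> (card (simples \<Delta>))\<^sup>2 * card (deep_pairs j)"
    by (simp add: card_cartesian_product power2_eq_square mult_ac)
  have "card (penetration_seqs \<Delta> (Suc j)) \<le> card (penetration_letters \<times> G)"
  proof (rule card_inj_on_le)
    have len: "w \<noteq> []" if "w \<in> penetration_seqs \<Delta> (Suc j)" for w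
      using that by (auto simp: penetration_seqs_def)
    show "inj_on (\<lambda>w. (hd w, tl w)) (penetration_seqs \<Delta> (Suc j))"
      using len by (intro inj_onI) (metis list.collapse prod.inject)
    have "hd w \<in> penetration_letters \<and> tl w \<in> G" if w: "w \<in> penetration_seqs \<Delta> (Suc j)" for w
    proof -
      obtain p v where v: "w = p # v" using len[OF w] by (cases w) auto
      have *: "p \<in> penetration_letters" "v \<in> penetration_seqs \<Delta> j"
        "v \<noteq> [] \<longrightarrow> penetration_edge p (hd v)"
        using w unfolding v penetration_seq_Cons by auto
      moreover have "v \<noteq> []" using *(2) j by (auto simp: penetration_seqs_def)
      ultimately show ?thesis by (auto simp: v G_def penetration_edge_def case_prod_beta)
    qed
    then show "(\<lambda>w. (hd w, tl w)) ` penetration_seqs \<Delta> (Suc j) \<subseteq> penetration_letters \<times> G" by auto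
  qed (simp add: finG finite_penetration_letters)
  also have "\<dots> \<le> card penetration_letters * ((card (simples \<Delta>))\<^sup>2 * card (deep_pairs j))"
    using G by (simp add: card_cartesian_product)
  finally show ?thesis by (simp add: mult.assoc)
qed

section \<open>Linear growth of the expected penetration distance\<close>

lemma expected_pd_eq:
  assumes "normal_words k \<noteq> {}" "(monoid_atoms :: 'a set) \<noteq> {}"
  shows "expected_pd \<Delta> k =
    (\<Sum>(w, a)\<in>normal_words k \<times> monoid_atoms. real (pd \<Delta> (prod_list w) a)) /
      (real (card (normal_words k)) * real (card (monoid_atoms :: 'a set)))"
proof -
  let ?A = "monoid_atoms :: 'a set"
  have bij: "bij_betw (map_prod prod_list id) (normal_words k \<times> ?A) (layer \<Delta> k \<times> ?A)"
    by (intro bij_betw_map_prod bij_betw_normal_words bij_betw_id)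
  have L: "layer \<Delta> k \<noteq> {}" "finite (layer \<Delta> k)"
    using bij_betw_imp_surj_on[OF bij_betw_normal_words[of k]] assms finite_imageI[OF finite_normal_words[of k], of prod_list]
    by auto
  have "pair_pmf (\<nu> \<Delta> k) \<mu>_atoms = pmf_of_set (layer \<Delta> k \<times> ?A)"
    unfolding \<nu>_def \<mu>_atoms_def
  proof (rule pmf_eqI)
    fix p :: "'a \<times> 'a"
    show "pmf (pair_pmf (pmf_of_set (layer \<Delta> k)) (pmf_of_set ?A)) p = pmf (pmf_of_set (layer \<Delta> k \<times> ?A)) p"
      using L assms finite_atoms
      by (cases p) (simp add: pmf_pair card_cartesian_product indicator_times)
  qed
  then have "expected_pd \<Delta> k =
      (\<Sum>(x, a)\<in>layer \<Delta> k \<times> ?A. real (pd \<Delta> x a)) / card (layer \<Delta> k \<times> ?A)"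
    unfolding expected_pd_def using L assms finite_atoms by (simp add: integral_pmf_of_set)
  also have "(\<Sum>(x, a)\<in>layer \<Delta> k \<times> ?A. real (pd \<Delta> x a)) =
      (\<Sum>(w, a)\<in>normal_words k \<times> ?A. real (pd \<Delta> (prod_list w) a))"
    using sum.reindex_bij_betw[OF bij, of "\<lambda>(x, a). real (pd \<Delta> x a)"] by (simp add: case_prod_beta)
  also have "card (layer \<Delta> k \<times> ?A) = card (normal_words k) * card ?A"
    using bij_betw_same_card[OF bij] by (metis card_cartesian_product)
  finally show ?thesis by simp
qed

text \<open>
  A pair \<open>(x, a)\<close> is counted on the left once for each depth at which it is deep, and all these depths
  lie between \<open>1\<close> and its penetration distance.
\<close>

lemma sum_pd_ge:
  "(\<Sum>j = 1..k. card {(w, a) \<in> normal_words k \<times> monoid_atoms. (drop (k - j) w, a) \<in> deep_pairs j})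
    \<le> (\<Sum>(w, a)\<in>normal_words k \<times> monoid_atoms. pd \<Delta> (prod_list w) a)"
proof -
  let ?W = "normal_words k \<times> (monoid_atoms :: 'a set)"
  let ?P = "\<lambda>p j. (drop (k - j) (fst p), snd p) \<in> deep_pairs j"
  have fin: "finite ?W" by (simp add: finite_normal_words finite_atoms)
  have "(\<Sum>j = 1..k. card {(w, a) \<in> ?W. (drop (k - j) w, a) \<in> deep_pairs j}) =
      (\<Sum>j = 1..k. \<Sum>p\<in>?W. of_bool (?P p j))"
  proof (rule sum.cong[OF refl])
    fix j
    have "{(w, a) \<in> ?W. (drop (k - j) w, a) \<in> deep_pairs j} = ?W \<inter> {p. ?P p j}" by auto
    then show "card {(w, a) \<in> ?W. (drop (k - j) w, a) \<in> deep_pairs j} = (\<Sum>p\<in>?W. of_bool (?P p j))"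
      using fin by simp
  qed
  also have "\<dots> = (\<Sum>p\<in>?W. \<Sum>j = 1..k. of_bool (?P p j))" by (rule sum.swap)
  also have "\<dots> = (\<Sum>p\<in>?W. card {j \<in> {1..k}. ?P p j})"
    by (simp add: Int_def)
  also have "\<dots> \<le> (\<Sum>p\<in>?W. pd \<Delta> (prod_list (fst p)) (snd p))"
  proof (rule sum_mono)
    fix p assume p: "p \<in> ?W"
    have "{j \<in> {1..k}. ?P p j} \<subseteq> {1..pd \<Delta> (prod_list (fst p)) (snd p)}"
      using pd_ge_of_deep p by auto
    then show "card {j \<in> {1..k}. ?P p j} \<le> pd \<Delta> (prod_list (fst p)) (snd p)"
      using card_mono[of "{1..pd \<Delta> (prod_list (fst p)) (snd p)}"] by fastforce
  qed
  finally show ?thesis by (simp add: case_prod_beta)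
qed

lemma strongly_connected_connecting_walk:
  assumes sc: "strongly_connected (normal_form_graph \<Delta>)"
    and edge: "(a, b) \<in> arcs (normal_form_graph \<Delta>)"
    and uv: "u \<in> proper_simples \<Delta>" "v \<in> proper_simples \<Delta>"
  shows "\<exists>c. set c \<subseteq> proper_simples \<Delta> \<and> successively (\<lambda>s t. compl \<Delta> s \<^bold>\<and> t = 1) (u # c @ [v])"
proof (rule in_trancl_imp_successively)
  let ?R = "{(s, t). s \<in> proper_simples \<Delta> \<and> t \<in> proper_simples \<Delta> \<and> compl \<Delta> s \<^bold>\<and> t = 1}"
  have ends: "arcs_ends (normal_form_graph \<Delta>) = ?R"
    by (auto simp: arcs_ends_def arc_to_ends_def normal_form_graph_def)
  have reach: "(s, t) \<in> ?R\<^sup>*" if "s \<in> proper_simples \<Delta>" "t \<in> proper_simples \<Delta>" for s t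
  proof -
    have "s \<rightarrow>\<^sup>*\<^bsub>normal_form_graph \<Delta>\<^esub> t"
      using sc that by (auto simp: strongly_connected_def normal_form_graph_def)
    then show ?thesis
      unfolding reachable_def ends by (rule rtrancl_on_rtranclI)
  qed
  have "(a, b) \<in> ?R" using edge by (auto simp: normal_form_graph_def)
  then show "(u, v) \<in> ?R\<^sup>+"
    using reach[OF uv(1), of a] reach[OF _ uv(2), of b]
    by (auto intro: rtrancl_into_trancl1 trancl_rtrancl_trancl)
qed

lemma growth_rate_layer: "growth_rate (layer \<Delta>) = growth_rate normal_words"
  using bij_betw_same_card[OF bij_betw_normal_words] by (simp add: growth_rate_def)

text \<open>
  The existence of an arc allows connecting walks with at least one arc between any two vertices. For
  every \<open>1 \<le> j \<le> k\<close> the pairs that are deep at depth \<open>j\<close> make up at least a fixed proportion of all pairs.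
\<close>

lemma expected_pd_linear_lower_bound:
  assumes sc: "strongly_connected (normal_form_graph \<Delta>)"
    and edge: "e \<in> arcs (normal_form_graph \<Delta>)"
    and growth: "growth_rate (penetration_seqs \<Delta>) = growth_rate (layer \<Delta>)"
  shows "\<exists>c>0. \<forall>k. layer \<Delta> k \<noteq> {} \<longrightarrow> c * real k \<le> expected_pd \<Delta> k"
proof -
  define g where "g = (\<lambda>k. card (normal_words k))"
  define \<beta> where "\<beta> = growth_rate normal_words"
  define D where "D = card penetration_letters * (card (simples \<Delta>))\<^sup>2"
  let ?A = "monoid_atoms :: 'a set"
  obtain a b where ab: "e = (a, b)" by (cases e)
  note conn = strongly_connected_connecting_walk[OF sc edge[unfolded ab]]
  obtain K where K: "K > 0" and into: "\<And>l v. v \<in> proper_simples \<Delta> \<Longrightarrow>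
      g l \<le> K * card (walks_into (proper_simples \<Delta>) (\<lambda>s t. compl \<Delta> s \<^bold>\<and> t = 1) l v)"
    unfolding g_def normal_words_def using walks_into_comparable[OF finite_proper_simples conn] by metis
  have fc: "factor_closed normal_words"
    using factor_closed_walks[OF finite_proper_simples] by (simp add: normal_words_def[abs_def])
  have fp: "factor_closed (penetration_seqs \<Delta>)"
    using factor_closed_walks[OF finite_penetration_letters] by (simp add: penetration_seqs_eq_walks[abs_def])
  have super: "g j * g l \<le> K * g (j + l)" for j l
    unfolding g_def normal_words_def
    by (rule card_walks_supermult[OF finite_proper_simples])
       (use into K in \<open>auto simp: g_def normal_words_def\<close>)
  have g_le: "real (g j) \<le> K * \<beta> ^ j" if "j \<ge> 1" for j
    unfolding g_def \<beta>_def by (rule card_le_growth_rate_power[OF fc that]) (use super in \<open>simp add: g_def\<close>)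
  have \<beta>_le: "\<beta> ^ Suc j \<le> D * card (deep_pairs j)" if "j \<ge> 1" for j
  proof -
    have "\<beta> ^ Suc j \<le> card (penetration_seqs \<Delta> (Suc j))"
      using growth_rate_power_le[OF fp, of "Suc j"] growth growth_rate_layer \<beta>_def by simp
    also have "\<dots> \<le> real (D * card (deep_pairs j))"
      using card_penetration_seqs_le_deep_pairs[OF that] unfolding D_def of_nat_le_iff .
    finally show ?thesis by simp
  qed
  obtain v where v: "v \<in> proper_simples \<Delta>"
    using sc by (auto simp: strongly_connected_def normal_form_graph_def)
  have "[v] \<in> normal_words 1" using v by (auto simp: normal_words_def walks_def)
  then have "0 < real (g 1)" using finite_normal_words[of 1] by (auto simp: g_def card_gt_0_iff)
  then have "0 < K * \<beta>" using g_le[of 1] by simp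
  then have \<beta>: "\<beta> > 0" using K by (simp add: zero_less_mult_iff)
  have "0 < \<beta> ^ Suc 1" using \<beta> by simp
  then have "0 < real D * card (deep_pairs 1)" using \<beta>_le[of 1] by simp
  then have D: "D > 0" by (cases "D = 0") auto
  have A: "card ?A > 0"
    using ex_atom_left_dvd[of v] v finite_atoms by (auto simp: proper_simples_def card_gt_0_iff)
  \<comment> \<open>\<open>K\<close> enters twice, through the bound on \<open>g j\<close> and through the count of prolongations\<close>
  define c where "c = \<beta> / (K\<^sup>2 * D * card ?A)"
  have "c > 0" using \<beta> K D A by (simp add: c_def)
  moreover have "c * real k \<le> expected_pd \<Delta> k" if "layer \<Delta> k \<noteq> {}" for k
  proof -
    define S where "S = (\<Sum>(w, a)\<in>normal_words k \<times> ?A. pd \<Delta> (prod_list w) a)"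
    define N where "N j = card {(w, a) \<in> normal_words k \<times> ?A. (drop (k - j) w, a) \<in> deep_pairs j}" for j
    have ne: "normal_words k \<noteq> {}" using that bij_betw_imp_surj_on[OF bij_betw_normal_words[of k]] by auto
    then have gk: "g k > 0" using finite_normal_words by (simp add: g_def card_gt_0_iff)
    have N: "\<beta> * g k \<le> real (K\<^sup>2 * D) * N j" if j: "j \<in> {1..k}" for j
    proof -
      have "card (deep_pairs j) * g (k - j) \<le> K * N j"
        using card_prolonged_walks[OF finite_proper_simples, of "deep_pairs j"
            "\<lambda>s t. compl \<Delta> s \<^bold>\<and> t = 1" j ?A "k - j" K] into[of _ "k - j"] j finite_atoms
        by (auto simp: N_def g_def normal_words_def deep_pairs_def)
      then have 1: "real (card (deep_pairs j)) * g (k - j) \<le> real K * N j"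
        by (metis of_nat_le_iff of_nat_mult)
      have "g k \<le> g j * g (k - j)" using factor_closed_card[OF fc, of j "k - j"] j by (simp add: g_def)
      then have "\<beta> * g k \<le> \<beta> * (real (g j) * g (k - j))"
        using \<beta> by (simp flip: of_nat_mult)
      also have "\<dots> \<le> \<beta> * (K * \<beta> ^ j * g (k - j))"
        using \<beta> g_le[of j] j by (intro mult_left_mono mult_right_mono) auto
      also have "\<dots> = K * \<beta> ^ Suc j * g (k - j)" by simp
      also have "\<dots> \<le> real K * real (D * card (deep_pairs j)) * real (g (k - j))"
        using \<beta>_le[of j] j by (intro mult_left_mono mult_right_mono) auto
      also have "\<dots> = K * D * (real (card (deep_pairs j)) * g (k - j))" by simp
      also have "\<dots> \<le> K * D * (real K * N j)"
        using 1 by (intro mult_left_mono) auto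
      finally show ?thesis by (simp add: power2_eq_square mult_ac)
    qed
    have "real k * (\<beta> * g k) \<le> (\<Sum>j = 1..k. real (K\<^sup>2 * D) * N j)"
      using sum_mono[of "{1..k}" "\<lambda>_. \<beta> * g k" "\<lambda>j. real (K\<^sup>2 * D) * N j"] N by simp
    also have "\<dots> = real (K\<^sup>2 * D) * real (\<Sum>j = 1..k. N j)"
      by (simp add: sum_distrib_left)
    also have "\<dots> \<le> real (K\<^sup>2 * D) * S"
      using sum_pd_ge[of k] unfolding N_def S_def by (intro mult_left_mono of_nat_mono) auto
    finally have "real k * (\<beta> * g k) \<le> real (K\<^sup>2 * D) * S" .
    then have "c * real k \<le> S / (real (g k) * card ?A)"
      using gk A K D by (simp add: c_def field_simps)
    also have "\<dots> = expected_pd \<Delta> k"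
      using expected_pd_eq[OF ne] A by (simp add: S_def g_def case_prod_beta card_gt_0_iff)
    finally show ?thesis .
  qed
  ultimately show ?thesis by blast
qed

text \<open>
  The exceptional case: a single vertex without a loop is strongly connected in the reflexive sense.
  This happens for the natural numbers with \<open>\<Delta> = 2\<close>. Then almost all layers are empty, and the
  limit over the nonempty ones is vacuous.
\<close>

lemma layer_eq_empty_of_no_arcs:
  assumes "arcs (normal_form_graph \<Delta>) = {}" "k \<ge> 2"
  shows "layer \<Delta> k = {}"
proof -
  have "w \<notin> normal_words k" for w
  proof
    assume w: "w \<in> normal_words k"
    then obtain s t v where "w = s # t # v"
      using assms(2) normal_words_length[OF w] by (cases w; cases "tl w") auto
    then have "(s, t) \<in> arcs (normal_form_graph \<Delta>)"
      using w by (auto simp: normal_words_def walks_def normal_form_graph_def)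
    then show False using assms by simp
  qed
  then have "normal_words k = {}" by blast
  then show ?thesis using bij_betw_imp_surj_on[OF bij_betw_normal_words[of k]] by simp
qed

end

theorem theorem4p8:
  fixes \<Delta> :: "'a::monoid_mult"
  assumes "garside_monoid \<Delta>"
    and "strongly_connected (normal_form_graph \<Delta>)"
    and "growth_rate (penetration_seqs \<Delta>) = growth_rate (layer \<Delta>)"
  shows "filterlim (expected_pd \<Delta>) at_top (nonempty_layers \<Delta>)"
proof -
  interpret garside_monoid \<Delta> by fact
  show ?thesis
    unfolding filterlim_at_top nonempty_layers_def eventually_inf_principal
  proof (intro allI)
    fix Z :: real
    show "\<forall>\<^sub>F k in sequentially. k \<in> {k. layer \<Delta> k \<noteq> {}} \<longrightarrow> Z \<le> expected_pd \<Delta> k"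
    proof (cases "arcs (normal_form_graph \<Delta>) = {}")
      case True
      show ?thesis
        using eventually_ge_at_top[of 2]
        by eventually_elim (simp add: layer_eq_empty_of_no_arcs[OF True])
    next
      case False
      then obtain c where c: "c > 0" "\<And>k. layer \<Delta> k \<noteq> {} \<Longrightarrow> c * real k \<le> expected_pd \<Delta> k"
        using expected_pd_linear_lower_bound assms by blast
      have "filterlim (\<lambda>k. c * real k) at_top sequentially"
        using c(1) filterlim_real_sequentially by (rule filterlim_tendsto_pos_mult_at_top[OF tendsto_const])
      then have "\<forall>\<^sub>F k in sequentially. Z \<le> c * real k" by (simp add: filterlim_at_top)
      then show ?thesis
        by eventually_elim (use c(2) in \<open>auto intro: order_trans\<close>)
    qed
  qed
qed

end
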